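(* For $i=1,2$, let $V_i$ be a right vector space over a skew field $D_i$ of finite dimension $n_i\geq 2$, and let $H_i$ be a group with $\mathrm{PEL}(V_i)\subseteq H_i\subseteq\mathrm{PGL}(V_i)$. Assume that $$\phi:(H_1,\mathrm{Gr}_1(V_1))\longrightarrow(H_2,\mathrm{Gr}_1(V_2))$$ is an isomorphism of permutation groups. Then $n_1=n_2$, and $\phi$ is induced by a semilinear isomorphism $V_1\to V_2$, except if $n_1=2$, in which case $\phi$ may also be induced by an anti-isomorphism of skew fields $D_1\to D_2$. (That is: if $n_1\ge 3$, then $\phi$ is induced by a semilinear isomorphism; if $n_1=2$, then $\phi$ is induced by a semilinear isomorphism or by an anti-isomorphism of skew fields.)
   Context: A skew field is a (not necessarily commutative) division ring; an anti-isomorphism $\theta$ of skew fields is an additive bijection with $1^\theta=1$ and $(xy)^\theta=y^\theta x^\theta$. $\mathrm{Gr}_1(V)$ is the set of one-dimensional subspaces of $V$. $\mathrm{GL}(V)$ is the group of $D$-linear bijections of $V$. A transvection of $V$ is a map $v\mapsto v+u\rho(v)$ with $u\in V$, $\rho\in\mathrm{Hom}_D(V,D)$ and $\rho(u)=0$; $\mathrm{EL}(V)$ is the subgroup of $\mathrm{GL}(V)$ generated by all transvections. $\mathrm{PGL}(V)$ and $\mathrm{PEL}(V)$ are the permutation groups induced by $\mathrm{GL}(V)$ and $\mathrm{EL}(V)$ on $\mathrm{Gr}_1(V)$. An isomorphism of permutation groups $(H_1,X_1)\to(H_2,X_2)$ consists of a group isomorphism $H_1\to H_2$ and a bijection $X_1\to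 X_2$ which is equivariant with respect to it. A semilinear isomorphism $F:V_1\to V_2$ is an additive bijection for which there is a skew field isomorphism $\theta:D_1\to D_2$ with $F(va)=F(v)a^\theta$ for all $v\in V_1$, $a\in D_1$. It induces $\phi$ if the bijection $\mathrm{Gr}_1(V_1)\to\mathrm{Gr}_1(V_2)$ belonging to $\phi$ is $p\mapsto F(p)$. If $V$ is two-dimensional over $D$ with base $b_0,b_1$, the set $\mathrm{Gr}_1(V)$ is identified with $D\cup\{\infty\}$ by letting $x\in D$ correspond to $(b_0x+b_1)D$ and $\infty$ to $b_0D$. For $n_1=n_2=2$, an anti-isomorphism $\theta:D_1\to D_2$ induces $\phi$ if, for suitable bases of $V_1$ and $V_2$, the bijection $\mathrm{Gr}_1(V_1)\to\mathrm{Gr}_1(V_2)$ belonging to $\phi$ becomes $x\mapsto x^\theta$ for $x\in D_1$ and $\infty\mapsto\infty$. *)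

theory Defs
  imports HOL.Hull "HOL-Algebra.Bij" "HOL-Algebra.Generated_Groups"
begin

section \<open>Right vector spaces over skew fields\<close>

text \<open>
  Skew fields are types of class \<^class>\<open>division_ring\<close>; a right vector space is given by its
  scalar multiplication \<open>s v a = va\<close> on the whole type. (The locales \<open>module\<close> and
  \<open>vector_space\<close> of the library require commutative scalars.)
\<close>

locale right_vector_space =
  fixes s :: "'v::ab_group_add \<Rightarrow> 'd::division_ring \<Rightarrow> 'v"
  assumes scale_add_left: "s (v + w) a = s v a + s w a"
    and scale_add_right: "s v (a + b) = s v a + s v b"
    and scale_scale: "s (s v a) b = s v (a * b)"
    and scale_one: "s v 1 = v"

definition right_subspace :: "('v::ab_group_add \<Rightarrow> 'd::division_ring \<Rightarrow> 'v) \<Rightarrow> 'v set \<Rightarrow> bool"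
  where "right_subspace s U \<longleftrightarrow>
    0 \<in> U \<and> (\<forall>v\<in>U. \<forall>w\<in>U. v + w \<in> U) \<and> (\<forall>v\<in>U. \<forall>a. s v a \<in> U)"

definition right_span :: "('v::ab_group_add \<Rightarrow> 'd::division_ring \<Rightarrow> 'v) \<Rightarrow> 'v set \<Rightarrow> 'v set"
  where "right_span s B = right_subspace s hull B"

definition right_independent :: "('v::ab_group_add \<Rightarrow> 'd::division_ring \<Rightarrow> 'v) \<Rightarrow> 'v set \<Rightarrow> bool"
  where "right_independent s B \<longleftrightarrow> (\<forall>b\<in>B. b \<notin> right_span s (B - {b}))"

definition right_base :: "('v::ab_group_add \<Rightarrow> 'd::division_ring \<Rightarrow> 'v) \<Rightarrow> 'v set \<Rightarrow> 'v set \<Rightarrow> bool"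
  where "right_base s U B \<longleftrightarrow> right_independent s B \<and> right_span s B = U"

definition has_finite_dim ::
  "('v::ab_group_add \<Rightarrow> 'd::division_ring \<Rightarrow> 'v) \<Rightarrow> 'v set \<Rightarrow> nat \<Rightarrow> bool"
  where "has_finite_dim s U n \<longleftrightarrow> (\<exists>B. right_base s U B \<and> finite B \<and> card B = n)"

definition Gr1 :: "('v::ab_group_add \<Rightarrow> 'd::division_ring \<Rightarrow> 'v) \<Rightarrow> 'v set set"
  where "Gr1 s = {p. right_subspace s p \<and> has_finite_dim s p 1}"

definition right_linear ::
  "('v::ab_group_add \<Rightarrow> 'd::division_ring \<Rightarrow> 'v) \<Rightarrow> ('w::ab_group_add \<Rightarrow> 'd \<Rightarrow> 'w) \<Rightarrow> ('v \<Rightarrow> 'w) \<Rightarrow> bool"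
  where "right_linear s t f \<longleftrightarrow>
    (\<forall>v w. f (v + w) = f v + f w) \<and> (\<forall>v a. f (s v a) = t (f v) a)"


section \<open>Linear groups and the permutation groups they induce\<close>

definition GL :: "('v::ab_group_add \<Rightarrow> 'd::division_ring \<Rightarrow> 'v) \<Rightarrow> ('v \<Rightarrow> 'v) monoid"
  where "GL s = BijGroup UNIV \<lparr>carrier := {g. bij g \<and> right_linear s s g}\<rparr>"

text \<open>Multiplication \<open>(*)\<close> makes \<open>D\<close> a right vector space over itself.\<close>

definition transvections :: "('v::ab_group_add \<Rightarrow> 'd::division_ring \<Rightarrow> 'v) \<Rightarrow> ('v \<Rightarrow> 'v) set"
  where "transvections s =
    {\<lambda>v. v + s u (\<rho> v) |u \<rho>. right_linear s (*) \<rho> \<and> \<rho> u = 0}"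

definition EL :: "('v::ab_group_add \<Rightarrow> 'd::division_ring \<Rightarrow> 'v) \<Rightarrow> ('v \<Rightarrow> 'v) set"
  where "EL s = generate (GL s) (transvections s)"

text \<open>Restriction, because the elements of \<^term>\<open>BijGroup X\<close> are extensional on \<open>X\<close>.\<close>

definition perm_Gr1 ::
  "('v::ab_group_add \<Rightarrow> 'd::division_ring \<Rightarrow> 'v) \<Rightarrow> ('v \<Rightarrow> 'v) \<Rightarrow> 'v set \<Rightarrow> 'v set"
  where "perm_Gr1 s g = (\<lambda>p\<in>Gr1 s. g ` p)"

definition PGL :: "('v::ab_group_add \<Rightarrow> 'd::division_ring \<Rightarrow> 'v) \<Rightarrow> ('v set \<Rightarrow> 'v set) set"
  where "PGL s = perm_Gr1 s ` carrier (GL s)"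

definition PEL :: "('v::ab_group_add \<Rightarrow> 'd::division_ring \<Rightarrow> 'v) \<Rightarrow> ('v set \<Rightarrow> 'v set) set"
  where "PEL s = perm_Gr1 s ` EL s"

definition perm_group_iso ::
  "('a \<Rightarrow> 'a) set \<Rightarrow> 'a set \<Rightarrow> ('b \<Rightarrow> 'b) set \<Rightarrow> 'b set
    \<Rightarrow> (('a \<Rightarrow> 'a) \<Rightarrow> ('b \<Rightarrow> 'b)) \<Rightarrow> ('a \<Rightarrow> 'b) \<Rightarrow> bool"
  where "perm_group_iso H1 X1 H2 X2 \<phi> \<beta> \<longleftrightarrow>
    \<phi> \<in> iso (BijGroup X1 \<lparr>carrier := H1\<rparr>) (BijGroup X2 \<lparr>carrier := H2\<rparr>) \<and>
    bij_betw \<beta> X1 X2 \<and>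
    (\<forall>h\<in>H1. \<forall>x\<in>X1. \<beta> (h x) = \<phi> h (\<beta> x))"


section \<open>Semilinear isomorphisms and anti-isomorphisms\<close>

definition skew_field_iso :: "('d::division_ring \<Rightarrow> 'e::division_ring) \<Rightarrow> bool"
  where "skew_field_iso \<theta> \<longleftrightarrow> bij \<theta> \<and> \<theta> 1 = 1 \<and>
    (\<forall>x y. \<theta> (x + y) = \<theta> x + \<theta> y) \<and> (\<forall>x y. \<theta> (x * y) = \<theta> x * \<theta> y)"

definition skew_field_anti_iso :: "('d::division_ring \<Rightarrow> 'e::division_ring) \<Rightarrow> bool"
  where "skew_field_anti_iso \<theta> \<longleftrightarrow> bij \<theta> \<and> \<theta> 1 = 1 \<and>
    (\<forall>x y. \<theta> (x + y) = \<theta> x + \<theta> y) \<and> (\<forall>x y. \<theta> (x * y) = \<theta> y * \<theta> x)"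

definition semilinear_iso ::
  "('v::ab_group_add \<Rightarrow> 'd::division_ring \<Rightarrow> 'v) \<Rightarrow> ('w::ab_group_add \<Rightarrow> 'e::division_ring \<Rightarrow> 'w)
    \<Rightarrow> ('v \<Rightarrow> 'w) \<Rightarrow> bool"
  where "semilinear_iso s t F \<longleftrightarrow> bij F \<and> (\<forall>v w. F (v + w) = F v + F w) \<and>
    (\<exists>\<theta>. skew_field_iso \<theta> \<and> (\<forall>v a. F (s v a) = t (F v) (\<theta> a)))"

definition induced_by_semilinear ::
  "('v::ab_group_add \<Rightarrow> 'd::division_ring \<Rightarrow> 'v) \<Rightarrow> ('v set \<Rightarrow> 'w set) \<Rightarrow> ('v \<Rightarrow> 'w) \<Rightarrow> bool"
  where "induced_by_semilinear s \<beta> F \<longleftrightarrow> (\<forall>p\<in>Gr1 s. \<beta> p = F ` p)"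

text \<open>
  The identification of \<open>D \<union> {\<infinity>}\<close> with \<open>Gr1\<close> of a plane with base \<open>b0, b1\<close>; \<open>None\<close> is \<open>\<infinity>\<close>
  and \<open>range (s v)\<close> is \<open>vD\<close>.
\<close>

definition line_point ::
  "('v::ab_group_add \<Rightarrow> 'd::division_ring \<Rightarrow> 'v) \<Rightarrow> 'v \<Rightarrow> 'v \<Rightarrow> 'd option \<Rightarrow> 'v set"
  where "line_point s b0 b1 z =
    (case z of Some x \<Rightarrow> range (s (s b0 x + b1)) | None \<Rightarrow> range (s b0))"

definition induced_by_anti_iso ::
  "('v::ab_group_add \<Rightarrow> 'd::division_ring \<Rightarrow> 'v) \<Rightarrow> ('w::ab_group_add \<Rightarrow> 'e::division_ring \<Rightarrow> 'w)
    \<Rightarrow> ('v set \<Rightarrow> 'w set) \<Rightarrow> ('d \<Rightarrow> 'e) \<Rightarrow> bool"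
  where "induced_by_anti_iso s t \<beta> \<theta> \<longleftrightarrow>
    (\<exists>b0 b1 c0 c1.
      b0 \<noteq> b1 \<and> right_base s UNIV {b0, b1} \<and> c0 \<noteq> c1 \<and> right_base t UNIV {c0, c1} \<and>
      (\<forall>z. \<beta> (line_point s b0 b1 z) = line_point t c0 c1 (map_option \<theta> z)))"

end

theory Submission
  imports Defs
begin

text \<open>
  Only two facts about \<open>H\<^sub>i\<close> are used: it contains the transvections, and its elements are induced by
  linear maps.

  If both dimensions are at least 3, then the noncollinear triples of points form a single orbit, so
  \<open>\<phi>\<close> either preserves noncollinearity or turns all noncollinear triples of one space into
  collinear ones; the latter would put all points on one line. The fundamental theorem of projective
  geometry then applies: in an affine chart \<open>e + w \<mapsto> e' + f w\<close> the map \<open>f\<close> is additive and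
  respects one-dimensional subspaces, hence is semilinear.

  On a projective line, the translations are the only abelian normal subgroup of the stabilizer of
  \<open>\<infinity>\<close> which is regular on the other points. Hence \<open>\<phi>\<close>, normalised on \<open>0, 1, \<infinity>\<close>, is an additive map
  \<open>\<theta>\<close>; since it also conjugates \<open>x \<mapsto> - x\<^sup>-\<^sup>1\<close> into the second group, \<open>x \<mapsto> \<theta>(x\<^sup>-\<^sup>1)\<^sup>-\<^sup>1\<close> is additive, too,
  and Hua's theorem shows that \<open>\<theta>\<close> is an isomorphism or an anti-isomorphism.
\<close>

section \<open>Right vector spaces\<close>

text \<open>The given data see only points, so the scalars have to be reconstructed. Collinearity
  does this in dimension at least 3 but says nothing on a line, where the group itself must carry
  the information. There an element fixing infinity has the form \<open>a * x * b + c\<close>,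
  because the image of \<open>b0 x + b1\<close> must be renormalised on the right. An
  anti-isomorphism turns such a map into one of the same form and is compatible with
  \<open>neg_inverse\<close>, whence the exception for lines. The two-sided factors are also the
  obstacle to recognising translations: over a noncommutative skew field the absence of fixed points
  does not make \<open>a * x * b + c\<close> a translation, and right multiplications by commutators
  are needed to force \<open>b\<close> into the centre. Equality of dimensions is obtained in two
  ways. Between spaces of dimension at least 3, the fundamental theorem for \<open>\<beta>\<close>
  and for its inverse gives one inequality each. A line is told apart from a higher space by the
  fixed points of commutators.\<close>

abbreviation pt :: "('v::ab_group_add \<Rightarrow> 'd::division_ring \<Rightarrow> 'v) \<Rightarrow> 'v \<Rightarrow> 'v set"
  where "pt s v \<equiv> range (s v)"

context right_vector_space
begin

lemma scale_zero_left [simp]: "s 0 a = 0"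
  using scale_add_left[of 0 0 a] by simp

lemma scale_zero_right [simp]: "s v 0 = 0"
  using scale_add_right[of v 0 0] by simp

lemma scale_minus_left [simp]: "s (- v) a = - s v a"
proof -
  have "s (- v) a + s v a = 0"
    by (metis scale_add_left ab_left_minus scale_zero_left)
  then show ?thesis by (rule minus_unique[symmetric, OF trans[OF add.commute]])
qed

lemma scale_minus_right [simp]: "s v (- a) = - s v a"
proof -
  have "s v (- a) + s v a = 0"
    by (metis scale_add_right ab_left_minus scale_zero_right)
  then show ?thesis by (rule minus_unique[symmetric, OF trans[OF add.commute]])
qed

lemma scale_diff_left: "s (v - w) a = s v a - s w a"
  using scale_add_left[of v "- w" a] by simp

lemma scale_diff_right: "s v (a - b) = s v a - s v b"
  using scale_add_right[of v a "- b"] by simp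

lemmas scale_simps = scale_add_left scale_add_right scale_diff_left scale_diff_right scale_scale

declare scale_one [simp]

lemma scale_eq_0_iff [simp]: "s v a = 0 \<longleftrightarrow> v = 0 \<or> a = 0"
proof -
  have "v = 0" if "s v a = 0" "a \<noteq> 0"
  proof -
    have "s (s v a) (inverse a) = v" using that(2) by (simp add: scale_scale)
    then show ?thesis using that(1) by simp
  qed
  then show ?thesis by auto
qed

lemma scale_cancel_left: "v \<noteq> 0 \<Longrightarrow> s v a = s v b \<longleftrightarrow> a = b"
  using scale_eq_0_iff[of v "a - b"] by (simp add: scale_diff_right del: scale_eq_0_iff)

section \<open>Spans, the exchange property and dimension\<close>

lemma subspace_span: "right_subspace s (right_span s A)"
  unfolding right_span_def
  by (rule hull_in) (fastforce simp: right_subspace_def)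

lemma span_superset: "A \<subseteq> right_span s A"
  unfolding right_span_def by (rule hull_subset)

lemma span_minimal: "A \<subseteq> U \<Longrightarrow> right_subspace s U \<Longrightarrow> right_span s A \<subseteq> U"
  unfolding right_span_def by (rule hull_minimal)

lemma span_mono: "A \<subseteq> B \<Longrightarrow> right_span s A \<subseteq> right_span s B"
  unfolding right_span_def by (rule hull_mono)

lemma span_base: "x \<in> A \<Longrightarrow> x \<in> right_span s A"
  using span_superset by blast

lemma
  assumes "right_subspace s U"
  shows subspace_0: "0 \<in> U"
    and subspace_add: "v \<in> U \<Longrightarrow> w \<in> U \<Longrightarrow> v + w \<in> U"
    and subspace_scale: "v \<in> U \<Longrightarrow> s v a \<in> U"
    and subspace_neg: "v \<in> U \<Longrightarrow> - v \<in> U"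
    and subspace_diff: "v \<in> U \<Longrightarrow> w \<in> U \<Longrightarrow> v - w \<in> U"
proof -
  show "0 \<in> U" and add: "v \<in> U \<Longrightarrow> w \<in> U \<Longrightarrow> v + w \<in> U"
    and scale: "v \<in> U \<Longrightarrow> s v a \<in> U" for v w a
    using assms by (auto simp: right_subspace_def)
  show neg: "v \<in> U \<Longrightarrow> - v \<in> U" for v
    using scale[of v "- 1"] by simp
  show "v \<in> U \<Longrightarrow> w \<in> U \<Longrightarrow> v - w \<in> U"
    using add[of v "- w"] neg[of w] by simp
qed

lemma subspace_scale_iff: "right_subspace s U \<Longrightarrow> a \<noteq> 0 \<Longrightarrow> s v a \<in> U \<longleftrightarrow> v \<in> U"
  using subspace_scale[of U v a] subspace_scale[of U "s v a" "inverse a"]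
  by (auto simp: scale_scale)

lemma span_empty [simp]: "right_span s {} = {0}"
proof
  show "right_span s {} \<subseteq> {0}"
    by (rule span_minimal) (auto simp: right_subspace_def)
  show "{0} \<subseteq> right_span s {}"
    using subspace_0[OF subspace_span] by simp
qed

lemma span_insert: "right_span s (insert x A) = {v. \<exists>a. v - s x a \<in> right_span s A}"
    (is "?L = ?R")
proof
  note sp = subspace_span[of A]
  have "right_subspace s ?R"
    unfolding right_subspace_def
  proof (intro conjI ballI allI)
    show "0 \<in> ?R" using subspace_0[OF sp] by (intro CollectI exI[of _ 0]) simp
  next
    fix v w assume "v \<in> ?R" "w \<in> ?R"
    then obtain a b where "v - s x a \<in> right_span s A" "w - s x b \<in> right_span s A" by auto
    from subspace_add[OF sp this] show "v + w \<in> ?R"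
      by (intro CollectI exI[of _ "a + b"]) (simp add: scale_simps algebra_simps)
  next
    fix v b assume "v \<in> ?R"
    then obtain a where "v - s x a \<in> right_span s A" by auto
    from subspace_scale[OF sp this, of b] show "s v b \<in> ?R"
      by (intro CollectI exI[of _ "a * b"]) (simp add: scale_simps algebra_simps)
  qed
  moreover have "insert x A \<subseteq> ?R"
  proof -
    have "x - s x 1 \<in> right_span s A" using subspace_0[OF sp] by simp
    moreover have "y - s x 0 \<in> right_span s A" if "y \<in> A" for y using that by (simp add: span_base)
    ultimately show ?thesis by blast
  qed
  ultimately show "?L \<subseteq> ?R" by (rule span_minimal[rotated])
  show "?R \<subseteq> ?L"
  proof
    fix v assume "v \<in> ?R"
    then obtain a where "v - s x a \<in> right_span s (insert x A)"
      using span_mono[of A "insert x A"] by auto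
    then have "(v - s x a) + s x a \<in> ?L"
      by (rule subspace_add[OF subspace_span]) (simp add: subspace_scale[OF subspace_span] span_base)
    then show "v \<in> ?L" by simp
  qed
qed

lemma span_sing: "right_span s {x} = pt s x"
  by (auto simp: span_insert)

lemma span_pair: "v \<in> right_span s {x, y} \<longleftrightarrow> (\<exists>a b. v = s x a + s y b)"
  by (auto simp: span_insert algebra_simps)

text \<open>The coefficient of \<open>x\<close> at \<open>y\<close> is nonzero, since otherwise
  \<open>x\<close> would lie in the span of \<open>A\<close>; it can therefore be inverted.\<close>

lemma span_exchange:
  assumes "x \<in> right_span s (insert y A)" "x \<notin> right_span s A"
  shows "y \<in> right_span s (insert x A)"
proof -
  obtain a where a: "x - s y a \<in> right_span s A" using assms(1) by (auto simp: span_insert)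
  then have "a \<noteq> 0" using assms(2) by auto
  have "s (- (x - s y a)) (inverse a) \<in> right_span s A"
    using a subspace_neg[OF subspace_span] subspace_scale[OF subspace_span] by blast
  then have "y - s x (inverse a) \<in> right_span s A"
    using \<open>a \<noteq> 0\<close> by (simp add: scale_simps)
  then show ?thesis by (auto simp: span_insert)
qed

lemma independent_insert:
  assumes "right_independent s A" "x \<notin> right_span s A"
  shows "right_independent s (insert x A)"
  unfolding right_independent_def
proof (intro ballI notI)
  fix b assume b: "b \<in> insert x A" "b \<in> right_span s (insert x A - {b})"
  have "x \<notin> A" using assms(2) span_base[of x A] by blast
  show False
  proof (cases "b = x")
    case True then show False using b \<open>x \<notin> A\<close> assms(2) by simp
  next
    case False
    then have "insert x A - {b} = insert x (A - {b})" "b \<in> A" using b by auto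
    then have "b \<in> right_span s (insert x (A - {b}))" "b \<notin> right_span s (A - {b})"
      using b assms(1) by (auto simp: right_independent_def)
    from span_exchange[OF this] have "x \<in> right_span s A"
      using \<open>b \<in> A\<close> by (simp add: insert_absorb)
    then show False using assms(2) by simp
  qed
qed

lemma independent_subset: "right_independent s A \<Longrightarrow> B \<subseteq> A \<Longrightarrow> right_independent s B"
  unfolding right_independent_def using span_mono by (metis Diff_mono subset_iff order_refl)

text \<open>Steinitz replacement, by induction on the number of elements of \<open>A\<close> outside
  \<open>B\<close>. Such an element \<open>a\<close> is traded for a \<open>b\<close> in
  \<open>B\<close> outside the span of \<open>A - {a}\<close>; if there were none, the span of
  \<open>B\<close>, and with it \<open>a\<close>, would lie in that span.\<close>

lemma independent_card_le:
  assumes "finite B" "finite A" "right_independent s A" "A \<subseteq> right_span s B"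
  shows "card A \<le> card B"
  using assms(2-)
proof (induction "card (A - B)" arbitrary: A rule: less_induct)
  case less
  show ?case
  proof (cases "A \<subseteq> B")
    case True then show ?thesis using assms(1) by (simp add: card_mono)
  next
    case False
    then obtain a where a: "a \<in> A" "a \<notin> B" by blast
    then have an: "a \<notin> right_span s (A - {a})"
      using less.prems(2) by (simp add: right_independent_def)
    have "\<not> B \<subseteq> right_span s (A - {a})"
      using span_minimal[OF _ subspace_span, of B] an a less.prems(3) by blast
    then obtain b where b: "b \<in> B" "b \<notin> right_span s (A - {a})" by blast
    let ?A = "insert b (A - {a})"
    have "b \<notin> A - {a}" using b(2) span_base[of b "A - {a}"] by blast
    then have "card ?A = card A"
      using less.prems(1) card.remove[OF less.prems(1) a(1)] by simp
    moreover have "right_independent s ?A"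
      using b less.prems(2) by (intro independent_insert) (auto intro: independent_subset)
    moreover have "?A \<subseteq> right_span s B" using b less.prems(3) by (auto simp: span_base)
    moreover have "card (?A - B) < card (A - B)"
      using a b less.prems(1) by (intro psubset_card_mono) auto
    ultimately show ?thesis using less.hyps[of ?A] less.prems(1) by simp
  qed
qed

lemma finite_dim_le:
  assumes "has_finite_dim s UNIV n" "right_span s B = UNIV" "finite B"
  shows "n \<le> card B"
  using assms independent_card_le[OF \<open>finite B\<close>]
  by (auto simp: has_finite_dim_def right_base_def)

lemma independent_pair_iff:
  assumes "x \<noteq> y"
  shows "right_independent s {x, y} \<longleftrightarrow> x \<notin> pt s y \<and> y \<notin> pt s x"
proof -
  have "{x, y} - {x} = {y}" "{x, y} - {y} = {x}" using assms by auto
  then show ?thesis by (simp add: right_independent_def span_sing)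
qed

section \<open>Points and their representing vectors\<close>

lemma pt_mem [simp]: "v \<in> pt s v"
  by (rule range_eqI[of _ _ 1]) simp

lemma in_ptE:
  assumes "v \<in> pt s w" "v \<noteq> 0"
  obtains a where "a \<noteq> 0" "v = s w a" "w = s v (inverse a)"
proof -
  obtain a where a: "v = s w a" using assms(1) by auto
  show thesis by (rule that[of a]) (use a assms(2) in \<open>auto simp: scale_scale\<close>)
qed

lemma pt_scale [simp]: "a \<noteq> 0 \<Longrightarrow> pt s (s v a) = pt s v"
proof -
  assume a: "a \<noteq> 0"
  have "s v b = s (s v a) (inverse a * b)" for b
    using a by (simp add: scale_scale mult.assoc[symmetric])
  then have "s v b \<in> pt s (s v a)" for b by blast
  then show ?thesis by (auto simp: scale_scale)
qed

lemma pt_eqI: "v \<noteq> 0 \<Longrightarrow> v \<in> pt s w \<Longrightarrow> pt s v = pt s w"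
  by (metis in_ptE pt_scale)

lemma subspace_pt: "right_subspace s (pt s v)"
  using subspace_span[of "{v}"] by (simp add: span_sing)

lemma pt_subset_iff: "right_subspace s U \<Longrightarrow> pt s v \<subseteq> U \<longleftrightarrow> v \<in> U"
  using subspace_scale pt_mem by blast

lemma Gr1_iff: "p \<in> Gr1 s \<longleftrightarrow> (\<exists>v. v \<noteq> 0 \<and> p = pt s v)"
proof
  assume "p \<in> Gr1 s"
  then obtain B where B: "right_independent s B" "right_span s B = p" "card B = 1"
    by (auto simp: Gr1_def has_finite_dim_def right_base_def)
  then obtain b where "B = {b}" by (auto simp: card_1_singleton_iff)
  then show "\<exists>v. v \<noteq> 0 \<and> p = pt s v"
    using B by (auto simp: right_independent_def span_sing)
next
  assume "\<exists>v. v \<noteq> 0 \<and> p = pt s v"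
  then obtain v where v: "v \<noteq> 0" "p = right_span s {v}" by (auto simp: span_sing)
  then have "right_base s p {v}" by (simp add: right_base_def right_independent_def)
  then show "p \<in> Gr1 s"
    unfolding Gr1_def has_finite_dim_def using v subspace_span[of "{v}"] by (auto intro!: exI[of _ "{v}"])
qed

lemma pt_in_Gr1 [simp]: "pt s v \<in> Gr1 s \<longleftrightarrow> v \<noteq> 0"
proof -
  have "v \<noteq> 0" if "w \<noteq> 0" "pt s v = pt s w" for w
    using that pt_mem[of w] by auto
  then show ?thesis by (auto simp: Gr1_iff)
qed

lemma Gr1E:
  assumes "p \<in> Gr1 s" obtains v where "v \<noteq> 0" "p = pt s v"
  using assms by (auto simp: Gr1_iff)

lemma Gr1_subspace: "p \<in> Gr1 s \<Longrightarrow> right_subspace s p"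
  by (auto simp: Gr1_def)

lemma Gr1_pt_eqI: "p \<in> Gr1 s \<Longrightarrow> v \<in> p \<Longrightarrow> v \<noteq> 0 \<Longrightarrow> p = pt s v"
  by (metis Gr1E pt_eqI)

lemma independent2:
  assumes "pt s x \<noteq> pt s y" "x \<noteq> 0" "y \<noteq> 0" "s x a + s y b = s x c + s y d"
  shows "a = c \<and> b = d"
proof -
  have e: "s x (a - c) = s y (d - b)" using assms(4) by (simp add: scale_simps algebra_simps)
  have "a - c = 0"
  proof (rule ccontr)
    assume "a - c \<noteq> 0"
    then have "d - b \<noteq> 0" using e assms by (metis scale_eq_0_iff)
    then show False using e assms(1) \<open>a - c \<noteq> 0\<close> by (metis pt_scale)
  qed
  then show ?thesis using e assms(3) by simp
qed

lemma span_Un_pt: "right_span s (pt s x \<union> pt s y) = right_span s {x, y}"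
proof
  show "right_span s (pt s x \<union> pt s y) \<subseteq> right_span s {x, y}"
    by (intro span_minimal subspace_span Un_least image_subsetI subspace_scale) (simp_all add: span_base)
  show "right_span s {x, y} \<subseteq> right_span s (pt s x \<union> pt s y)"
    by (rule span_mono) auto
qed

subsection \<open>Linear forms\<close>

lemma
  assumes "right_linear s t f" "right_vector_space t"
  shows right_linear_add: "f (v + w) = f v + f w"
    and right_linear_scale: "f (s v a) = t (f v) a"
    and right_linear_0: "f 0 = 0"
    and right_linear_neg: "f (- v) = - f v"
    and right_linear_diff: "f (v - w) = f v - f w"
proof -
  show add: "f (v + w) = f v + f w" and sc: "f (s v a) = t (f v) a" for v w a
    using assms(1) by (auto simp: right_linear_def)
  show z: "f 0 = 0" using add[of 0 0] by simp
  show neg: "f (- v) = - f v" for v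
    using add[of "- v" v] z by (simp add: eq_neg_iff_add_eq_0)
  show "f (v - w) = f v - f w" using add[of v "- w"] neg by simp
qed

end

lemma right_vector_space_mult: "right_vector_space ((*) :: 'd::division_ring \<Rightarrow> _)"
  by standard (auto simp: algebra_simps)

context right_vector_space
begin

lemmas linear_form_simps =
  right_linear_add[OF _ right_vector_space_mult] right_linear_scale[OF _ right_vector_space_mult]
  right_linear_0[OF _ right_vector_space_mult] right_linear_neg[OF _ right_vector_space_mult]
  right_linear_diff[OF _ right_vector_space_mult]

text \<open>By Zorn's lemma there is a subspace maximal among those that contain \<open>S\<close>
  and miss \<open>y\<close>. Adjoining any further \<open>v\<close> captures \<open>y\<close>, and
  exchange then puts \<open>v\<close> into \<open>M + yD\<close>, so \<open>M\<close> is a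
  hyperplane complementary to \<open>yD\<close>.\<close>

lemma complement_exists:
  assumes "right_subspace s S" "y \<notin> S"
  shows "\<exists>M. right_subspace s M \<and> S \<subseteq> M \<and> y \<notin> M \<and> (\<forall>v. \<exists>a. v - s y a \<in> M)"
proof -
  let ?A = "{M. right_subspace s M \<and> S \<subseteq> M \<and> y \<notin> M}"
  have "\<exists>M\<in>?A. \<forall>X\<in>?A. M \<subseteq> X \<longrightarrow> X = M"
  proof (rule subset_Zorn_nonempty)
    show "?A \<noteq> {}" using assms by blast
    fix C assume C: "C \<noteq> {}" "subset.chain ?A C"
    have dir: "\<exists>Z\<in>C. v \<in> Z \<and> w \<in> Z" if vw: "v \<in> \<Union>C" "w \<in> \<Union>C" for v w
    proof -
      obtain X Y where XY: "X \<in> C" "v \<in> X" "Y \<in> C" "w \<in> Y" using vw by blast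
      then have "X \<subseteq> Y \<or> Y \<subseteq> X" using C(2) by (auto simp: subset_chain_def)
      then show ?thesis using XY by blast
    qed
    have sub: "right_subspace s Z" if "Z \<in> C" for Z
      using C(2) that by (auto simp: subset_chain_def)
    have "right_subspace s (\<Union>C)"
      unfolding right_subspace_def
    proof (intro conjI ballI allI)
      show "0 \<in> \<Union>C" using C(1) sub subspace_0 by blast
      show "v + w \<in> \<Union>C" if "v \<in> \<Union>C" "w \<in> \<Union>C" for v w
        using dir[OF that] sub subspace_add by blast
      show "s v a \<in> \<Union>C" if "v \<in> \<Union>C" for v a
        using that sub subspace_scale by blast
    qed
    then show "\<Union>C \<in> ?A" using C by (auto simp: subset_chain_def)
  qed
  then obtain M where "M \<in> ?A" and mx: "\<forall>X\<in>?A. M \<subseteq> X \<longrightarrow> X = M" by (rule bexE)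
  then have M: "right_subspace s M" "S \<subseteq> M" "y \<notin> M" by simp_all
  have max: "y \<in> X" if "right_subspace s X" "M \<subseteq> X" "v \<in> X" "v \<notin> M" for X v
    using bspec[OF mx, of X] that M(2) by auto
  have spM: "right_span s M = M"
    using span_minimal[OF order_refl M(1)] span_superset[of M] by blast
  have "\<exists>a. v - s y a \<in> M" for v
  proof (cases "v \<in> M")
    case True then show ?thesis by (intro exI[of _ 0]) simp
  next
    case False
    then have "y \<in> right_span s (insert v M)"
      using span_superset[of "insert v M"] by (intro max[OF subspace_span]) auto
    then have "v \<in> right_span s (insert y M)"
      by (rule span_exchange) (simp add: spM M)
    then show ?thesis by (simp add: span_insert spM)
  qed
  then show ?thesis using M by blast
qed

text \<open>The form reads off the coefficient at \<open>y\<close> modulo such a hyperplane.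
  Vanishing on \<open>S\<close> is what makes the transvections built from it fix \<open>S\<close>
  pointwise.\<close>

lemma linear_form_exists:
  assumes "right_subspace s S" "y \<notin> S"
  obtains \<rho> where "right_linear s (*) \<rho>" "\<And>v. v \<in> S \<Longrightarrow> \<rho> v = 0" "\<rho> y = 1"
proof -
  obtain M where M: "right_subspace s M" "S \<subseteq> M" "y \<notin> M" "\<And>v. \<exists>a. v - s y a \<in> M"
    using complement_exists[OF assms] by blast
  define \<rho> where "\<rho> v = (THE a. v - s y a \<in> M)" for v
  have uni: "a = b" if "v - s y a \<in> M" "v - s y b \<in> M" for v a b
  proof (rule ccontr)
    assume "a \<noteq> b"
    have "(v - s y a) - (v - s y b) \<in> M" using that subspace_diff[OF M(1)] by blast
    then have "s y (b - a) \<in> M" by (simp add: scale_simps)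
    then show False using subspace_scale_iff[OF M(1)] \<open>a \<noteq> b\<close> M(3) by simp
  qed
  have \<rho>: "\<rho> v = a" if "v - s y a \<in> M" for v a
    unfolding \<rho>_def using that uni by blast
  have mem: "v - s y (\<rho> v) \<in> M" for v using M(4)[of v] \<rho> by auto
  show thesis
  proof
    show "right_linear s (*) \<rho>"
      unfolding right_linear_def
    proof (intro conjI allI)
      fix v w a
      show "\<rho> (v + w) = \<rho> v + \<rho> w"
        using subspace_add[OF M(1) mem[of v] mem[of w]] by (intro \<rho>) (simp add: scale_simps algebra_simps)
      show "\<rho> (s v a) = \<rho> v * a"
        using subspace_scale[OF M(1) mem[of v], of a] by (intro \<rho>) (simp add: scale_simps)
    qed
    show "\<rho> v = 0" if "v \<in> S" for v using that M by (intro \<rho>) auto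
    show "\<rho> y = 1" by (intro \<rho>) (simp add: subspace_0[OF M(1)])
  qed
qed

end

section \<open>The fundamental theorem of projective geometry\<close>

text \<open>\<open>not_plane\<close> expresses dimension at least 3 without a base. Collinearity is
  an equivalence so that lines can be pulled back as well as pushed forward.\<close>

locale collineation =
  V1: right_vector_space s1 + V2: right_vector_space s2
  for s1 :: "'v1::ab_group_add \<Rightarrow> 'd1::division_ring \<Rightarrow> 'v1"
    and s2 :: "'v2::ab_group_add \<Rightarrow> 'd2::division_ring \<Rightarrow> 'v2" +
  fixes \<beta> :: "'v1 set \<Rightarrow> 'v2 set"
  assumes bij: "bij_betw \<beta> (Gr1 s1) (Gr1 s2)"
    and collinear: "\<lbrakk>p \<in> Gr1 s1; q \<in> Gr1 s1; r \<in> Gr1 s1; p \<noteq> q\<rbrakk> \<Longrightarrow>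
      \<beta> r \<subseteq> right_span s2 (\<beta> p \<union> \<beta> q) \<longleftrightarrow> r \<subseteq> right_span s1 (p \<union> q)"
    and not_plane: "right_span s1 {x, y} \<noteq> UNIV"
begin

lemma inj: "p \<in> Gr1 s1 \<Longrightarrow> q \<in> Gr1 s1 \<Longrightarrow> \<beta> p = \<beta> q \<longleftrightarrow> p = q"
  using bij by (auto simp: bij_betw_def inj_on_eq_iff)

lemma \<beta>_Gr1: "p \<in> Gr1 s1 \<Longrightarrow> \<beta> p \<in> Gr1 s2"
  using bij by (auto simp: bij_betw_def)

lemma span_iff:
  assumes "x \<noteq> 0" "y \<noteq> 0" "z \<noteq> 0" "pt s1 x \<noteq> pt s1 y"
    and "\<beta> (pt s1 x) = pt s2 x'" "\<beta> (pt s1 y) = pt s2 y'" "\<beta> (pt s1 z) = pt s2 z'"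
  shows "z' \<in> right_span s2 {x', y'} \<longleftrightarrow> z \<in> right_span s1 {x, y}"
  using collinear[of "pt s1 x" "pt s1 y" "pt s1 z"] assms
  by (simp add: V1.span_Un_pt V2.span_Un_pt V1.pt_subset_iff[OF V1.subspace_span]
      V2.pt_subset_iff[OF V2.subspace_span])

end

text \<open>Points off the hyperplane \<open>\<rho> w = 0\<close> are written \<open>e + w\<close>,
  those on it are directions. Prescribing \<open>e'\<close> removes the scalar ambiguity:
  \<open>f w\<close> is the representative of the image direction for which \<open>e' + f w\<close>
  represents the image of \<open>e + w\<close>. The vector \<open>w0\<close> is a direction on which
  scalars will be read off.\<close>

locale affine_chart = collineation +
  fixes \<rho> e e' f w0
  assumes form: "right_linear s1 (*) \<rho>" and \<rho>_e: "\<rho> e = 1"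
    and \<beta>_e: "\<beta> (pt s1 e) = pt s2 e'"
    and f_0: "f 0 = 0"
    and \<beta>_f: "\<lbrakk>\<rho> w = 0; w \<noteq> 0\<rbrakk> \<Longrightarrow> \<beta> (pt s1 w) = pt s2 (f w)"
    and \<beta>_chart: "\<rho> w = 0 \<Longrightarrow> \<beta> (pt s1 (e + w)) = pt s2 (e' + f w)"
    and w0: "\<rho> w0 = 0" "w0 \<noteq> 0"
begin

lemmas \<rho>_simps = V1.linear_form_simps[OF form]

lemma e_nz: "e \<noteq> 0"
  using \<rho>_e \<rho>_simps(3) by auto

lemma f_nz: "\<rho> w = 0 \<Longrightarrow> w \<noteq> 0 \<Longrightarrow> f w \<noteq> 0"
  using \<beta>_f[of w] \<beta>_Gr1[of "pt s1 w"] by auto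

lemma chart_nz: "\<rho> w = 0 \<Longrightarrow> e + w \<noteq> 0"
  using \<rho>_simps(1)[of e w] \<rho>_simps(3) \<rho>_e by auto

lemma f_pt_eq_iff:
  assumes "\<rho> x = 0" "\<rho> y = 0" "x \<noteq> 0" "y \<noteq> 0"
  shows "pt s2 (f x) = pt s2 (f y) \<longleftrightarrow> pt s1 x = pt s1 y"
  using inj[of "pt s1 x" "pt s1 y"] \<beta>_f assms by simp

text \<open>Here the chart uses dimension at least 3: a vector outside the span of \<open>e\<close>
  and \<open>w\<close>, projected along \<open>e\<close> into the kernel of \<open>\<rho>\<close>,
  stays outside \<open>wD\<close>.\<close>

lemma other_point:
  obtains z where "\<rho> z = 0" "z \<noteq> 0" "pt s1 z \<noteq> pt s1 w"
proof -
  obtain y where y: "y \<notin> right_span s1 {e, w}" using not_plane[of e w] by blast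
  let ?z = "y - s1 e (\<rho> y)"
  have "?z \<notin> pt s1 w"
  proof
    assume "?z \<in> pt s1 w"
    then obtain a where "?z = s1 w a" by auto
    then have "y = s1 e (\<rho> y) + s1 w a" by (simp add: algebra_simps)
    then show False using y by (auto simp: V1.span_pair)
  qed
  moreover have "?z \<noteq> 0" using \<open>?z \<notin> pt s1 w\<close> V1.subspace_0[OF V1.subspace_pt] by metis
  moreover have "pt s1 ?z \<noteq> pt s1 w" using \<open>?z \<notin> pt s1 w\<close> V1.pt_mem[of ?z] by metis
  moreover have "\<rho> ?z = 0" by (simp add: \<rho>_simps \<rho>_e)
  ultimately show thesis using that by blast
qed

lemma e'_notin_span:
  assumes "\<rho> x = 0" "\<rho> y = 0" "x \<noteq> 0" "y \<noteq> 0" "pt s1 x \<noteq> pt s1 y"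
  shows "e' \<notin> right_span s2 {f x, f y}"
proof
  assume "e' \<in> right_span s2 {f x, f y}"
  then have "e \<in> right_span s1 {x, y}"
    using span_iff[of x y e] assms e_nz \<beta>_f \<beta>_e by simp
  then obtain a b where "e = s1 x a + s1 y b" by (auto simp: V1.span_pair)
  then have "\<rho> e = 0" using assms by (simp add: \<rho>_simps)
  then show False by (simp add: \<rho>_e)
qed

text \<open>The line through \<open>e + x\<close> and \<open>e + y\<close> has direction
  \<open>x - y\<close>, and \<open>f (x - y)\<close> lies in the span of \<open>f x\<close> and
  \<open>f y\<close>. As \<open>e'\<close> lies outside that span, comparing the coefficients at
  \<open>e'\<close> shows that \<open>e' + f y\<close> enters \<open>e' + f x\<close> with factor
  1.\<close>

lemma f_diff_mem:
  assumes x: "\<rho> x = 0" "x \<noteq> 0" and y: "\<rho> y = 0" "y \<noteq> 0" and ne: "pt s1 x \<noteq> pt s1 y"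
  shows "f x - f y \<in> pt s2 (f (x - y))"
proof -
  have xy: "x - y \<noteq> 0" "\<rho> (x - y) = 0" using ne x y by (auto simp: \<rho>_simps)
  have "pt s1 (e + y) \<noteq> pt s1 (x - y)"
  proof
    assume "pt s1 (e + y) = pt s1 (x - y)"
    then obtain a where a: "e + y = s1 (x - y) a" using V1.pt_mem[of "e + y"] by auto
    have "\<rho> (e + y) = 0" unfolding a by (simp add: \<rho>_simps x y)
    then show False by (simp add: \<rho>_simps \<rho>_e y)
  qed
  moreover have "e + x \<in> right_span s1 {e + y, x - y}"
    unfolding V1.span_pair by (intro exI[of _ 1]) simp
  ultimately have "e' + f x \<in> right_span s2 {e' + f y, f (x - y)}"
    using span_iff[of "e + y" "x - y" "e + x"] x y xy \<beta>_chart \<beta>_f chart_nz by simp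
  then obtain a b where ab: "e' + f x = s2 (e' + f y) a + s2 (f (x - y)) b"
    by (auto simp: V2.span_pair)
  have "x - y \<in> right_span s1 {x, y}"
    unfolding V1.span_pair by (intro exI[of _ 1] exI[of _ "- 1"]) simp
  then have "f (x - y) \<in> right_span s2 {f x, f y}"
    using span_iff[of x y "x - y"] x y xy ne \<beta>_f by simp
  then obtain c d where cd: "f (x - y) = s2 (f x) c + s2 (f y) d"
    by (auto simp: V2.span_pair)
  have "s2 e' (1 - a) = s2 (f x) (c * b - 1) + s2 (f y) (a + d * b)"
    using ab unfolding cd by (simp add: V2.scale_simps algebra_simps)
  then have "s2 e' (1 - a) \<in> right_span s2 {f x, f y}" unfolding V2.span_pair by blast
  then have "1 - a = 0"
    using e'_notin_span[OF x(1) y(1) x(2) y(2) ne] V2.subspace_scale_iff[OF V2.subspace_span]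
    by blast
  then have "f x - f y = s2 (f (x - y)) b" using ab by (simp add: algebra_simps)
  then show ?thesis by blast
qed

lemma pt_add_neq:
  assumes "x \<noteq> 0" "pt s1 x \<noteq> pt s1 y" "v \<in> pt s1 y"
  shows "pt s1 (x + v) \<noteq> pt s1 y" "x + v \<noteq> 0"
proof -
  have *: "x \<notin> pt s1 y" using assms V1.pt_eqI by blast
  have "x + v \<notin> pt s1 y"
    using V1.subspace_diff[OF V1.subspace_pt _ assms(3), of "x + v"] * by auto
  then show "pt s1 (x + v) \<noteq> pt s1 y" "x + v \<noteq> 0"
    using V1.pt_mem[of "x + v"] V1.subspace_0[OF V1.subspace_pt, of y] by metis+
qed

text \<open>The fourth vertex of a parallelogram: \<open>f (x + y)\<close> differs from
  \<open>f y\<close> by a multiple of \<open>f x\<close> and from \<open>f x\<close> by a multiple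
  of \<open>f y\<close>. Independence of \<open>f x\<close> and \<open>f y\<close> forces both
  factors to be 1.\<close>

lemma f_add_independent:
  assumes x: "\<rho> x = 0" "x \<noteq> 0" and y: "\<rho> y = 0" "y \<noteq> 0" and ne: "pt s1 x \<noteq> pt s1 y"
  shows "f (x + y) = f x + f y"
proof -
  have xy: "pt s1 (x + y) \<noteq> pt s1 y" "x + y \<noteq> 0" "pt s1 (x + y) \<noteq> pt s1 x"
    using pt_add_neq[of x y y] pt_add_neq[of y x x] assms by (auto simp: add.commute)
  have \<rho>xy: "\<rho> (x + y) = 0" using x y by (simp add: \<rho>_simps)
  obtain a where a: "f (x + y) - f y = s2 (f x) a"
    using f_diff_mem[OF \<rho>xy xy(2) y xy(1)] by auto
  obtain b where b: "f (x + y) - f x = s2 (f y) b"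
    using f_diff_mem[OF \<rho>xy xy(2) x xy(3)] by auto
  have "s2 (f x) a + s2 (f y) 1 = s2 (f x) 1 + s2 (f y) b"
    using a b by (simp add: algebra_simps)
  then have "a = 1"
    using V2.independent2[of "f x" "f y" a 1 1 b] f_pt_eq_iff f_nz assms by blast
  then show ?thesis using a by (simp add: algebra_simps)
qed

text \<open>For dependent \<open>x\<close> and \<open>y\<close> an independent direction
  \<open>z\<close> is added, and \<open>f\<close> at \<open>x + y + z\<close> is computed with both
  bracketings; apart from the trivial case \<open>x + y = 0\<close>, the sums that are split have
  independent summands.\<close>

lemma f_add:
  assumes x: "\<rho> x = 0" and y: "\<rho> y = 0"
  shows "f (x + y) = f x + f y"
proof (cases "x = 0 \<or> y = 0 \<or> pt s1 x \<noteq> pt s1 y")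
  case True
  then show ?thesis
    using f_add_independent[of x y] x y by (metis f_0 add_0_left add_0_right)
next
  case False
  obtain z where z: "\<rho> z = 0" "z \<noteq> 0" "pt s1 z \<noteq> pt s1 x" using other_point .
  have yx: "y \<in> pt s1 x" using False V1.pt_mem[of y] by auto
  have "f (x + (y + z)) = f x + f (y + z)"
    using f_add_independent[of x "y + z"] pt_add_neq[OF z(2,3) yx] x y z False
    by (simp add: \<rho>_simps add.commute)
  also have "f (y + z) = f y + f z"
    using f_add_independent[of y z] y z False by simp
  finally have 1: "f (x + (y + z)) = f x + (f y + f z)" .
  have 2: "f ((x + y) + z) = f (x + y) + f z"
  proof (cases "x + y = 0")
    case True then show ?thesis by (simp add: f_0)
  next
    case nz: False
    have "pt s1 (x + y) = pt s1 x"
      using V1.pt_eqI[OF nz] V1.subspace_add[OF V1.subspace_pt _ yx] by simp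
    then show ?thesis using f_add_independent[of "x + y" z] x y z nz by (simp add: \<rho>_simps)
  qed
  show ?thesis using 1 2 by (simp add: algebra_simps)
qed

section \<open>The scalar map belonging to the chart\<close>

definition ratio where "ratio w a = (SOME c. f (s1 w a) = s2 (f w) c)"

lemma f_scale_ratio:
  assumes "\<rho> w = 0" "w \<noteq> 0"
  shows "f (s1 w a) = s2 (f w) (ratio w a)"
proof -
  have "\<exists>c. f (s1 w a) = s2 (f w) c"
  proof (cases "a = 0")
    case True then show ?thesis by (intro exI[of _ 0]) (simp add: f_0)
  next
    case False
    then have "pt s2 (f (s1 w a)) = pt s2 (f w)"
      using f_pt_eq_iff[of "s1 w a" w] assms by (simp add: \<rho>_simps)
    then show ?thesis using V2.pt_mem[of "f (s1 w a)"] by auto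
  qed
  then show ?thesis unfolding ratio_def by (rule someI_ex)
qed

text \<open>Expanding \<open>f\<close> at \<open>(x + y) a\<close> once as a sum and once as a
  multiple of \<open>f (x + y)\<close> identifies both ratios with
  \<open>ratio (x + y) a\<close>.\<close>

lemma ratio_independent:
  assumes x: "\<rho> x = 0" "x \<noteq> 0" and y: "\<rho> y = 0" "y \<noteq> 0" and ne: "pt s1 x \<noteq> pt s1 y"
  shows "ratio x a = ratio y a"
proof -
  have xy: "x + y \<noteq> 0" "\<rho> (x + y) = 0"
    using pt_add_neq[of x y y] assms by (auto simp: \<rho>_simps)
  have "s2 (f x) (ratio x a) + s2 (f y) (ratio y a) = f (s1 (x + y) a)"
    using x y by (simp add: V1.scale_simps f_add f_scale_ratio \<rho>_simps)
  also have "\<dots> = s2 (f x) (ratio (x + y) a) + s2 (f y) (ratio (x + y) a)"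
    using x y xy by (simp add: f_scale_ratio f_add V2.scale_simps)
  finally show ?thesis
    using V2.independent2[of "f x" "f y"] f_pt_eq_iff f_nz assms by metis
qed

definition \<theta> where "\<theta> = ratio w0"

lemma f_scale:
  assumes "\<rho> w = 0"
  shows "f (s1 w a) = s2 (f w) (\<theta> a)"
proof (cases "w = 0")
  case True then show ?thesis by (simp add: f_0)
next
  case False
  \<comment> \<open>For \<open>w\<close> in the same point as \<open>w0\<close> the comparison has
    to pass through another direction.\<close>
  obtain z where z: "\<rho> z = 0" "z \<noteq> 0" "pt s1 z \<noteq> pt s1 w0" using other_point .
  have "ratio w a = \<theta> a"
  proof (cases "pt s1 w = pt s1 w0")
    case True
    then have "ratio w a = ratio z a" "ratio w0 a = ratio z a"
      using ratio_independent[of w z] ratio_independent[of w0 z] z w0 assms False by auto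
    then show ?thesis by (simp add: \<theta>_def)
  next
    case ne: False
    then show ?thesis using ratio_independent[of w w0] w0 assms False by (simp add: \<theta>_def)
  qed
  then show ?thesis using f_scale_ratio[OF assms False] by simp
qed

lemma f_w0_nz: "f w0 \<noteq> 0" using f_nz w0 by simp

lemma \<theta>_eqI: "s2 (f w0) (\<theta> a) = s2 (f w0) b \<Longrightarrow> \<theta> a = b"
  using V2.scale_cancel_left[OF f_w0_nz] by simp

text \<open>The point represented by \<open>e' + f w0 b\<close> has a preimage on the line through
  \<open>e\<close> and \<open>w0\<close>, since collinearity is reflected. This preimage is not the
  direction \<open>w0\<close>, so it can be normalised to \<open>e + w0 a\<close>, and comparing
  coefficients yields \<open>\<theta> a = b\<close>.\<close>

lemma \<theta>_surj: "\<exists>a. \<theta> a = b"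
proof -
  have e'_nz: "e' \<noteq> 0" using \<beta>_e \<beta>_Gr1[of "pt s1 e"] e_nz by auto
  have ne: "pt s1 e \<noteq> pt s1 w0"
  proof
    assume "pt s1 e = pt s1 w0"
    then obtain a where "e = s1 w0 a" using V1.pt_mem[of e] by auto
    then show False using \<rho>_e w0 by (simp add: \<rho>_simps)
  qed
  then have ne': "pt s2 e' \<noteq> pt s2 (f w0)"
    using inj[of "pt s1 e" "pt s1 w0"] w0 e_nz \<beta>_e \<beta>_f by simp
  then have e'_notin: "e' \<notin> pt s2 (f w0)" using V2.pt_eqI[OF e'_nz] by blast
  let ?u = "e' + s2 (f w0) b"
  have u: "?u \<notin> pt s2 (f w0)"
  proof
    assume "?u \<in> pt s2 (f w0)"
    from V2.subspace_diff[OF V2.subspace_pt this, of "s2 (f w0) b"] e'_notin show False by simp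
  qed
  then have "?u \<noteq> 0" using V2.subspace_0[OF V2.subspace_pt] by metis
  then have "pt s2 ?u \<in> \<beta> ` Gr1 s1" using bij by (simp add: bij_betw_def)
  then obtain v where v: "v \<noteq> 0" "\<beta> (pt s1 v) = pt s2 ?u" by (auto elim!: V1.Gr1E)
  have "?u \<in> right_span s2 {e', f w0}" unfolding V2.span_pair by (intro exI[of _ 1] exI[of _ b]) simp
  then have "v \<in> right_span s1 {e, w0}"
    using span_iff[of e w0 v] w0 e_nz ne v \<beta>_e \<beta>_f by simp
  then obtain c d where cd: "v = s1 e c + s1 w0 d" by (auto simp: V1.span_pair)
  have "c \<noteq> 0"
  proof
    assume "c = 0"
    then have "pt s1 v = pt s1 w0" using cd v(1) by auto
    then have "pt s2 ?u = pt s2 (f w0)" using v \<beta>_f w0 by simp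
    then show False using u V2.pt_mem[of ?u] by simp
  qed
  let ?a = "d * inverse c"
  have "v = s1 (e + s1 w0 ?a) c"
    using \<open>c \<noteq> 0\<close> by (simp add: cd V1.scale_simps mult.assoc)
  then have "pt s2 ?u = pt s2 (e' + f (s1 w0 ?a))"
    using v(2) \<beta>_chart[of "s1 w0 ?a"] w0 \<open>c \<noteq> 0\<close> by (simp add: \<rho>_simps)
  then obtain k where k: "?u = s2 (e' + s2 (f w0) (\<theta> ?a)) k"
    using V2.pt_mem[of ?u] w0 by (auto simp: f_scale)
  then have "s2 e' 1 + s2 (f w0) b = s2 e' k + s2 (f w0) (\<theta> ?a * k)" by (simp add: V2.scale_simps)
  then have "1 = k \<and> b = \<theta> ?a * k"
    using V2.independent2[OF ne' e'_nz f_w0_nz] by blast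
  then show ?thesis by auto
qed

lemma \<theta>_iso: "skew_field_iso \<theta>"
proof -
  have add: "\<theta> (a + b) = \<theta> a + \<theta> b" for a b
    using f_add[of "s1 w0 a" "s1 w0 b"] w0
    by (intro \<theta>_eqI) (simp add: f_scale[symmetric] \<rho>_simps V1.scale_simps V2.scale_simps)
  have mult: "\<theta> (a * b) = \<theta> a * \<theta> b" for a b
  proof (rule \<theta>_eqI)
    have "s2 (f w0) (\<theta> (a * b)) = f (s1 (s1 w0 a) b)" using w0 by (simp add: f_scale V1.scale_scale)
    also have "\<dots> = s2 (f w0) (\<theta> a * \<theta> b)"
      using w0 by (simp add: f_scale \<rho>_simps V2.scale_scale)
    finally show "s2 (f w0) (\<theta> (a * b)) = s2 (f w0) (\<theta> a * \<theta> b)" .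
  qed
  have one: "\<theta> 1 = 1" using f_scale[of w0 1] w0 by (intro \<theta>_eqI) simp
  have "\<theta> 0 = 0" using add[of 0 0] by simp
  have ker: "a = 0" if "\<theta> a = 0" for a
  proof (rule ccontr)
    assume "a \<noteq> 0"
    then have "\<theta> a * \<theta> (inverse a) = 1" using mult[of a "inverse a"] one by simp
    then show False using that by simp
  qed
  have "inj \<theta>"
  proof (rule injI)
    fix a b assume "\<theta> a = \<theta> b"
    then have "\<theta> (a - b) = 0" using add[of "a - b" b] by simp
    then show "a = b" using ker[of "a - b"] by simp
  qed
  then show ?thesis
    unfolding skew_field_iso_def bij_def surj_def using add mult one \<theta>_surj by metis
qed

text \<open>The extension of \<open>f\<close> that sends \<open>e\<close> to \<open>e'\<close>,
  along the decomposition of the space into the kernel of \<open>\<rho>\<close> and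
  \<open>eD\<close>.\<close>

definition F where "F v = f (v - s1 e (\<rho> v)) + s2 e' (\<theta> (\<rho> v))"

lemma F_semilinear: "F (v + w) = F v + F w" "F (s1 v a) = s2 (F v) (\<theta> a)"
proof -
  have ker: "\<rho> (v - s1 e (\<rho> v)) = 0" for v by (simp add: \<rho>_simps \<rho>_e)
  have add: "\<theta> (a + b) = \<theta> a + \<theta> b" and mult: "\<theta> (a * b) = \<theta> a * \<theta> b" for a b
    using \<theta>_iso by (auto simp: skew_field_iso_def)
  have "v + w - s1 e (\<rho> v + \<rho> w) = (v - s1 e (\<rho> v)) + (w - s1 e (\<rho> w))"
    by (simp add: V1.scale_simps)
  then show "F (v + w) = F v + F w"
    by (simp only: F_def \<rho>_simps(1) f_add[OF ker ker] add V2.scale_add_right add_ac)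
  have "s1 v a - s1 e (\<rho> v * a) = s1 (v - s1 e (\<rho> v)) a"
    by (simp add: V1.scale_simps)
  then show "F (s1 v a) = s2 (F v) (\<theta> a)"
    by (simp only: F_def \<rho>_simps(2) f_scale[OF ker] mult V2.scale_simps)
qed

lemma \<beta>_F:
  assumes "v \<noteq> 0"
  shows "\<beta> (pt s1 v) = pt s2 (F v)"
proof (cases "\<rho> v = 0")
  case True
  have "\<theta> 0 = 0" using \<theta>_iso by (auto simp: skew_field_iso_def) (metis add_cancel_right_right)
  then show ?thesis using True assms by (simp add: F_def \<beta>_f)
next
  case False
  let ?a = "inverse (\<rho> v)" and ?b = "\<rho> v"
  \<comment> \<open>Rescaling \<open>v\<close> to \<open>\<rho>\<close>-value 1 brings its point
    into the form \<open>e + w\<close> of the chart.\<close>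
  let ?w = "s1 v ?a - e"
  have 1: "\<theta> 1 = 1" and mult: "\<theta> (a * b) = \<theta> a * \<theta> b" for a b
    using \<theta>_iso by (auto simp: skew_field_iso_def)
  have "\<theta> ?a * \<theta> ?b = 1" using mult[of ?a ?b] 1 False by simp
  then have nz: "\<theta> ?a \<noteq> 0" by auto
  have w: "\<rho> ?w = 0" using False by (simp add: \<rho>_simps \<rho>_e)
  have "pt s1 v = pt s1 (e + ?w)" using False by simp
  also have "\<beta> \<dots> = pt s2 (e' + f ?w)" using \<beta>_chart[OF w] .
  also have "e' + f ?w = F (s1 v ?a)"
    using False by (simp add: F_def \<rho>_simps 1)
  also have "pt s2 \<dots> = pt s2 (F v)" using nz by (simp add: F_semilinear)
  finally show ?thesis .
qed

lemma F_iso: "semilinear_iso s1 s2 F" and F_induces: "induced_by_semilinear s1 \<beta> F"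
proof -
  have \<theta>s: "\<exists>a. \<theta> a = b" for b using \<theta>_surj .
  have nz: "F v \<noteq> 0" if "v \<noteq> 0" for v
    using \<beta>_Gr1[of "pt s1 v"] \<beta>_F[OF that] that by simp
  have "inj F"
  proof (rule injI)
    fix v w assume "F v = F w"
    then have "F (v - w) = 0" using F_semilinear(1)[of "v - w" w] by simp
    then show "v = w" using nz[of "v - w"] by auto
  qed
  moreover have "\<exists>v. F v = u" for u
  proof (cases "u = 0")
    case True
    have "F 0 = 0" using F_semilinear(1)[of 0 0] by simp
    then show ?thesis using True by blast
  next
    case False
    then have "pt s2 u \<in> \<beta> ` Gr1 s1" using bij by (simp add: bij_betw_def)
    then obtain v where v: "v \<noteq> 0" "\<beta> (pt s1 v) = pt s2 u" by (auto elim!: V1.Gr1E)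
    then have "u \<in> pt s2 (F v)" using \<beta>_F V2.pt_mem[of u] by simp
    then obtain b where "u = s2 (F v) b" by auto
    then show ?thesis using \<theta>s[of b] F_semilinear(2) by metis
  qed
  ultimately have "bij F" by (metis bij_def surj_def)
  then show "semilinear_iso s1 s2 F"
    unfolding semilinear_iso_def using F_semilinear \<theta>_iso by blast
  have "F ` pt s1 v = pt s2 (F v)" for v
  proof
    show "F ` pt s1 v \<subseteq> pt s2 (F v)" by (auto simp: F_semilinear)
    show "pt s2 (F v) \<subseteq> F ` pt s1 v"
    proof
      fix u assume "u \<in> pt s2 (F v)"
      then obtain b where "u = s2 (F v) b" by auto
      then show "u \<in> F ` pt s1 v" using \<theta>s[of b] F_semilinear(2) by (metis image_eqI rangeI)
    qed
  qed
  then show "induced_by_semilinear s1 \<beta> F"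
    unfolding induced_by_semilinear_def by (metis V1.Gr1E \<beta>_F)
qed

end

section \<open>Affine charts for arbitrary collineations\<close>

context collineation
begin

text \<open>The image of \<open>e + w\<close> is represented by \<open>e' a + x b\<close>, and both
  coefficients are nonzero because this point differs from the images of \<open>e\<close> and
  \<open>w\<close>. Division on the right by \<open>a\<close> keeps the point and normalises the
  first coefficient.\<close>

lemma affine_lift:
  assumes e: "e \<noteq> 0" "\<beta> (pt s1 e) = pt s2 e'" and w: "w \<noteq> 0" "pt s1 e \<noteq> pt s1 w"
  shows "\<exists>u. \<beta> (pt s1 w) = pt s2 u \<and> \<beta> (pt s1 (e + w)) = pt s2 (e' + u)"
proof -
  have e': "e' \<noteq> 0" using \<beta>_Gr1[of "pt s1 e"] e by simp
  obtain x where x: "x \<noteq> 0" "\<beta> (pt s1 w) = pt s2 x"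
    using \<beta>_Gr1[of "pt s1 w"] w by (auto elim!: V2.Gr1E)
  have "e \<notin> pt s1 w" "w \<notin> pt s1 e" using w e V1.pt_eqI by metis+
  have ew: "e + w \<notin> pt s1 w"
  proof
    assume "e + w \<in> pt s1 w"
    from V1.subspace_diff[OF V1.subspace_pt this, of w] \<open>e \<notin> pt s1 w\<close> show False by simp
  qed
  have ew': "e + w \<notin> pt s1 e"
  proof
    assume "e + w \<in> pt s1 e"
    from V1.subspace_diff[OF V1.subspace_pt this, of e] \<open>w \<notin> pt s1 e\<close> show False by simp
  qed
  have nz: "e + w \<noteq> 0" using ew V1.subspace_0[OF V1.subspace_pt] by metis
  obtain y where y: "y \<noteq> 0" "\<beta> (pt s1 (e + w)) = pt s2 y"
    using \<beta>_Gr1[of "pt s1 (e + w)"] nz by (auto elim!: V2.Gr1E)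
  have "e + w \<in> right_span s1 {e, w}" unfolding V1.span_pair by (intro exI[of _ 1]) simp
  then have "y \<in> right_span s2 {e', x}" using span_iff[of e w "e + w"] e w nz x y by simp
  then obtain a b where ab: "y = s2 e' a + s2 x b" by (auto simp: V2.span_pair)
  have "a \<noteq> 0"
  proof
    assume "a = 0"
    then have "pt s2 y = pt s2 x" using ab y by auto
    then have "pt s1 (e + w) = pt s1 w" using inj[of "pt s1 (e + w)" "pt s1 w"] nz w x y by simp
    then show False using ew V1.pt_mem[of "e + w"] by simp
  qed
  have "b \<noteq> 0"
  proof
    assume "b = 0"
    then have "pt s2 y = pt s2 e'" using ab y by auto
    then have "pt s1 (e + w) = pt s1 e" using inj[of "pt s1 (e + w)" "pt s1 e"] nz e y by simp
    then show False using ew' V1.pt_mem[of "e + w"] by simp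
  qed
  let ?u = "s2 x (b * inverse a)"
  have "pt s2 ?u = pt s2 x" using \<open>a \<noteq> 0\<close> \<open>b \<noteq> 0\<close> by simp
  moreover have "y = s2 (e' + ?u) a" using \<open>a \<noteq> 0\<close> by (simp add: ab V2.scale_simps mult.assoc)
  then have "pt s2 y = pt s2 (e' + ?u)" using \<open>a \<noteq> 0\<close> by simp
  ultimately show ?thesis using x y by (intro exI[of _ ?u]) simp
qed

theorem fundamental_theorem:
  "\<exists>F. semilinear_iso s1 s2 F \<and> induced_by_semilinear s1 \<beta> F"
proof -
  \<comment> \<open>Degenerate pairs make \<open>not_plane\<close> produce a nonzero vector and then
    a vector outside \<open>eD\<close>.\<close>
  obtain e where "e \<notin> right_span s1 {0, 0}" using not_plane by blast
  then have e: "e \<noteq> 0" using V1.span_base by auto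
  obtain w1 where w1: "w1 \<notin> right_span s1 {e, e}" using not_plane by blast
  obtain \<rho> where \<rho>: "right_linear s1 (*) \<rho>" "\<rho> e = 1"
    using V1.linear_form_exists[of "{0}" e] e by (auto simp: right_subspace_def)
  note \<rho>_simps = V1.linear_form_simps[OF \<rho>(1)]
  define w0 where "w0 = w1 - s1 e (\<rho> w1)"
  have "w0 \<noteq> 0" using w1 by (auto simp: w0_def V1.span_sing)
  have "\<rho> w0 = 0" by (simp add: w0_def \<rho>_simps \<rho>)
  obtain e' where e': "\<beta> (pt s1 e) = pt s2 e'"
    using \<beta>_Gr1[of "pt s1 e"] e by (auto elim!: V2.Gr1E)
  have "\<exists>u. (w = 0 \<longrightarrow> u = 0) \<and> (w \<noteq> 0 \<longrightarrow> \<beta> (pt s1 w) = pt s2 u) \<and>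
      \<beta> (pt s1 (e + w)) = pt s2 (e' + u)" if "\<rho> w = 0" for w
  proof (cases "w = 0")
    case True then show ?thesis using e' by (intro exI[of _ 0]) simp
  next
    case False
    have "pt s1 e \<noteq> pt s1 w"
    proof
      assume "pt s1 e = pt s1 w"
      then obtain a where "e = s1 w a" using V1.pt_mem[of e] by auto
      then show False using \<rho> that by (simp add: \<rho>_simps)
    qed
    then show ?thesis using affine_lift[OF e e' False] False by auto
  qed
  then obtain f where f: "\<And>w. \<rho> w = 0 \<Longrightarrow> (w = 0 \<longrightarrow> f w = 0) \<and>
      (w \<noteq> 0 \<longrightarrow> \<beta> (pt s1 w) = pt s2 (f w)) \<and> \<beta> (pt s1 (e + w)) = pt s2 (e' + f w)"
    by metis
  interpret affine_chart s1 s2 \<beta> \<rho> e e' f w0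
    by unfold_locales (use \<rho> e' f \<rho>_simps(3) \<open>w0 \<noteq> 0\<close> \<open>\<rho> w0 = 0\<close> in auto)
  show ?thesis using F_iso F_induces by blast
qed

end

section \<open>Groups containing all transvections\<close>

definition noncollinear where
  "noncollinear s p q r \<longleftrightarrow> p \<in> Gr1 s \<and> q \<in> Gr1 s \<and> r \<in> Gr1 s \<and> p \<noteq> q \<and>
    \<not> r \<subseteq> right_span s (p \<union> q)"

lemma (in right_vector_space) linear_image_pt:
  "right_linear s s g \<Longrightarrow> g ` pt s v = pt s (g v)"
  by (auto simp: right_linear_def image_image)

lemma (in right_vector_space) linear_image_Gr1:
  assumes "bij g" "right_linear s s g" "p \<in> Gr1 s"
  shows "g ` p \<in> Gr1 s"
proof -
  obtain v where v: "v \<noteq> 0" "p = pt s v" using assms(3) by (rule Gr1E)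
  have "g v \<noteq> 0"
    using v(1) right_linear_0[OF assms(2) right_vector_space_axioms] assms(1) by (metis bij_pointE)
  then show ?thesis using v assms(2) by (simp add: linear_image_pt)
qed

text \<open>Permutations of points are replaced by linear maps inducing them, so that one can
  compute with vectors.\<close>

locale transvection_group = right_vector_space s
  for s :: "'v::ab_group_add \<Rightarrow> 'd::division_ring \<Rightarrow> 'v" +
  fixes L :: "('v \<Rightarrow> 'v) set"
  assumes bij_L: "g \<in> L \<Longrightarrow> bij g"
    and linear_L: "g \<in> L \<Longrightarrow> right_linear s s g"
    and comp_L: "g \<in> L \<Longrightarrow> h \<in> L \<Longrightarrow> g \<circ> h \<in> L"
    and inv_L: "g \<in> L \<Longrightarrow> inv_into UNIV g \<in> L"
    and transvection_L: "right_linear s (*) \<rho> \<Longrightarrow> \<rho> u = 0 \<Longrightarrow> (\<lambda>v. v + s u (\<rho> v)) \<in> L"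
begin

lemmas L_simps =
  right_linear_add[OF linear_L right_vector_space_axioms]
  right_linear_scale[OF linear_L right_vector_space_axioms]
  right_linear_0[OF linear_L right_vector_space_axioms]
  right_linear_neg[OF linear_L right_vector_space_axioms]
  right_linear_diff[OF linear_L right_vector_space_axioms]

lemma L_eq_0_iff: "g \<in> L \<Longrightarrow> g v = 0 \<longleftrightarrow> v = 0"
  using L_simps(3)[of g] bij_L[of g] by (metis bij_pointE)

lemma image_pt: "g \<in> L \<Longrightarrow> g ` pt s v = pt s (g v)"
  using linear_L by (rule linear_image_pt)

lemma image_Gr1: "g \<in> L \<Longrightarrow> p \<in> Gr1 s \<Longrightarrow> g ` p \<in> Gr1 s"
  using bij_L linear_L by (rule linear_image_Gr1)

lemma image_subspace:
  assumes "g \<in> L" "right_subspace s U"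
  shows "right_subspace s (g ` U)"
  unfolding right_subspace_def
proof (intro conjI ballI allI)
  show "0 \<in> g ` U" using subspace_0[OF assms(2)] L_simps(3)[OF assms(1)] by force
  show "v + w \<in> g ` U" if "v \<in> g ` U" "w \<in> g ` U" for v w
    using that subspace_add[OF assms(2)] by (auto simp: L_simps(1)[OF assms(1), symmetric])
  show "s v a \<in> g ` U" if "v \<in> g ` U" for v a
    using that subspace_scale[OF assms(2)] by (auto simp: L_simps(2)[OF assms(1), symmetric])
qed

lemma image_span_subset: "g \<in> L \<Longrightarrow> right_span s (g ` A) \<subseteq> g ` right_span s A"
  by (intro span_minimal image_subspace subspace_span image_mono span_superset)

lemma noncollinear_image:
  assumes "g \<in> L" "noncollinear s p q r"
  shows "noncollinear s (g ` p) (g ` q) (g ` r)"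
proof -
  have inj: "inj g" using bij_L[OF assms(1)] by (rule bij_is_inj)
  have "\<not> g ` r \<subseteq> g ` right_span s (p \<union> q)"
    using assms(2) inj_image_subset_iff[OF inj] by (simp add: noncollinear_def)
  then have "\<not> g ` r \<subseteq> right_span s (g ` p \<union> g ` q)"
    using image_span_subset[OF assms(1), of "p \<union> q"] by (auto simp: image_Un)
  then show ?thesis
    using assms inj_image_eq_iff[OF inj] by (simp add: noncollinear_def image_Gr1)
qed

text \<open>The transvection \<open>v + (y - x) \<rho> v\<close> carries \<open>x\<close> to
  \<open>y\<close> if \<open>\<rho>\<close> is 1 at \<open>x\<close> and vanishes at
  \<open>y - x\<close>; it fixes \<open>S\<close> if \<open>\<rho>\<close> vanishes there. Such a
  form need not exist when \<open>y\<close> lies in \<open>xD + S\<close>, but then \<open>y\<close>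
  can be rescaled so that its difference from \<open>x\<close> falls into \<open>S\<close>.\<close>

lemma transvection_moving:
  assumes S: "right_subspace s S" and x: "x \<notin> S" and y: "y \<notin> S"
  shows "\<exists>g\<in>L. (\<forall>v\<in>S. g v = v) \<and> g ` pt s x = pt s y"
proof (cases "y \<in> right_span s (insert x S)")
  case True
  obtain \<rho> where \<rho>: "right_linear s (*) \<rho>" "\<And>v. v \<in> S \<Longrightarrow> \<rho> v = 0" "\<rho> x = 1"
    using linear_form_exists[OF S x] by blast
  note \<rho>_simps = linear_form_simps[OF \<rho>(1)]
  have "right_span s S = S" using span_minimal[OF order_refl S] span_superset[of S] by blast
  then obtain c where c: "y - s x c \<in> S" using True by (auto simp: span_insert)
  then have "c \<noteq> 0" using y by auto
  have "\<rho> y = c" using \<rho>(2)[OF c] \<rho>(3) by (simp add: \<rho>_simps)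
  let ?u = "s y (inverse c) - x"
  let ?g = "\<lambda>v. v + s ?u (\<rho> v)"
  have "?g \<in> L" by (rule transvection_L) (use \<rho> \<open>\<rho> y = c\<close> \<open>c \<noteq> 0\<close> in \<open>simp_all add: \<rho>_simps\<close>)
  moreover have "?g x = s y (inverse c)" by (simp add: \<rho>)
  ultimately show ?thesis using \<rho> \<open>c \<noteq> 0\<close> by (intro bexI[of _ ?g]) (simp_all add: image_pt)
next
  case False
  let ?S = "right_span s (insert (y - x) S)"
  have S_eq: "right_span s S = S" using span_minimal[OF order_refl S] span_superset[of S] by blast
  have "x \<notin> ?S"
  proof
    assume "x \<in> ?S"
    then have "y - x \<in> right_span s (insert x S)" by (rule span_exchange) (simp add: S_eq x)
    from subspace_add[OF subspace_span this span_base, of x] False show False by simp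
  qed
  from linear_form_exists[OF subspace_span this]
  obtain \<rho> where \<rho>: "right_linear s (*) \<rho>" "\<And>v. v \<in> ?S \<Longrightarrow> \<rho> v = 0" "\<rho> x = 1"
    by blast
  have \<rho>0: "\<rho> (y - x) = 0" "\<And>v. v \<in> S \<Longrightarrow> \<rho> v = 0"
    by (auto intro!: \<rho>(2) span_base)
  let ?g = "\<lambda>v. v + s (y - x) (\<rho> v)"
  have "?g \<in> L" by (rule transvection_L) (use \<rho> \<rho>0 in simp_all)
  moreover have "?g x = y" by (simp add: \<rho>)
  ultimately show ?thesis using \<rho>0 by (intro bexI[of _ ?g]) (simp_all add: image_pt)
qed

lemma moving_point:
  assumes "right_subspace s S" "p \<in> Gr1 s" "q \<in> Gr1 s" "\<not> p \<subseteq> S" "\<not> q \<subseteq> S"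
  shows "\<exists>g\<in>L. (\<forall>r. r \<subseteq> S \<longrightarrow> g ` r = r) \<and> g ` p = q"
proof -
  obtain x y where "p = pt s x" "q = pt s y" using assms by (metis Gr1E)
  then obtain g where g: "g \<in> L" "\<forall>v\<in>S. g v = v" "g ` p = q"
    using transvection_moving[of S x y] assms by (auto simp: pt_subset_iff)
  have "g ` r = r" if "r \<subseteq> S" for r using g(2) that by (force simp: image_def)
  then show ?thesis using g by blast
qed

text \<open>The points are placed one at a time, by maps fixing every point in the span of those
  already placed: the zero space, then \<open>p'\<close>, then the line through \<open>p'\<close>
  and \<open>q'\<close>.\<close>

lemma transitive_noncollinear:
  assumes "noncollinear s p q r" "noncollinear s p' q' r'"
  shows "\<exists>g\<in>L. g ` p = p' \<and> g ` q = q' \<and> g ` r = r'"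
proof -
  have sub0: "right_subspace s {0}" by (auto simp: right_subspace_def)
  have nc0: "\<not> x \<subseteq> {0}" if "x \<in> Gr1 s" for x
    using that pt_mem by (metis Gr1E singletonD subsetD)
  have nc1: "\<not> y \<subseteq> x" if nc: "noncollinear s x y z" for x y z
  proof
    assume "y \<subseteq> x"
    obtain v where v: "v \<noteq> 0" "y = pt s v" using nc unfolding noncollinear_def by (metis Gr1E)
    have "v \<in> x" using \<open>y \<subseteq> x\<close> v(2) pt_mem[of v] by blast
    then have "x = y" using Gr1_pt_eqI[of x v] v nc by (simp add: noncollinear_def)
    then show False using nc by (simp add: noncollinear_def)
  qed
  obtain g1 where g1: "g1 \<in> L" "g1 ` p = p'"
    using moving_point[OF sub0, of p p'] assms nc0 by (auto simp: noncollinear_def)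
  define q1 r1 where "q1 = g1 ` q" and "r1 = g1 ` r"
  have nc: "noncollinear s p' q1 r1"
    using noncollinear_image[OF g1(1) assms(1)] g1 by (simp add: q1_def r1_def)
  have "\<exists>g\<in>L. (\<forall>r. r \<subseteq> p' \<longrightarrow> g ` r = r) \<and> g ` q1 = q'"
    by (rule moving_point) (use nc assms nc1[OF nc] nc1[OF assms(2)] in
        \<open>simp_all add: noncollinear_def Gr1_subspace\<close>)
  then obtain g2 where g2: "g2 \<in> L" "g2 ` p' = p'" "g2 ` q1 = q'" by auto
  define r2 where "r2 = g2 ` r1"
  have nc2: "noncollinear s p' q' r2"
    using noncollinear_image[OF g2(1) nc] g2 by (simp add: r2_def)
  have "\<exists>g\<in>L. (\<forall>r. r \<subseteq> right_span s (p' \<union> q') \<longrightarrow> g ` r = r) \<and> g ` r2 = r'"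
    by (rule moving_point) (use nc2 assms in \<open>simp_all add: noncollinear_def subspace_span\<close>)
  then obtain g3 where g3: "g3 \<in> L" "g3 ` p' = p'" "g3 ` q' = q'" "g3 ` r2 = r'"
    using span_superset[of "p' \<union> q'"] by auto
  let ?g = "g3 \<circ> (g2 \<circ> g1)"
  have "?g \<in> L" using g1 g2 g3 by (intro comp_L)
  moreover have "?g ` p = p'" "?g ` q = q'" "?g ` r = r'"
    using g1 g2 g3 by (simp_all only: image_comp[symmetric] q1_def r1_def r2_def)
  ultimately show ?thesis by blast
qed

end

text \<open>Only the conjugation of induced permutations is kept from \<open>\<phi>\<close>.
  Requiring it in both directions makes the situation symmetric in the two spaces.\<close>

locale permutation_iso =
  V1: transvection_group s1 L1 + V2: transvection_group s2 L2
  for s1 :: "'v1::ab_group_add \<Rightarrow> 'd1::division_ring \<Rightarrow> 'v1" and L1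
    and s2 :: "'v2::ab_group_add \<Rightarrow> 'd2::division_ring \<Rightarrow> 'v2" and L2 +
  fixes \<beta> :: "'v1 set \<Rightarrow> 'v2 set"
  assumes bij: "bij_betw \<beta> (Gr1 s1) (Gr1 s2)"
    and conj: "g \<in> L1 \<Longrightarrow> \<exists>h\<in>L2. \<forall>p\<in>Gr1 s1. \<beta> (g ` p) = h ` \<beta> p"
    and conj': "h \<in> L2 \<Longrightarrow> \<exists>g\<in>L1. \<forall>p\<in>Gr1 s1. \<beta> (g ` p) = h ` \<beta> p"
begin

lemma inj: "p \<in> Gr1 s1 \<Longrightarrow> q \<in> Gr1 s1 \<Longrightarrow> \<beta> p = \<beta> q \<longleftrightarrow> p = q"
  using bij by (auto simp: bij_betw_def inj_on_eq_iff)

lemma \<beta>_Gr1: "p \<in> Gr1 s1 \<Longrightarrow> \<beta> p \<in> Gr1 s2"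
  using bij by (auto simp: bij_betw_def)

lemma \<beta>_surj: "q \<in> Gr1 s2 \<Longrightarrow> \<exists>p\<in>Gr1 s1. \<beta> p = q"
  using bij unfolding bij_betw_def by (metis imageE)

text \<open>Lets one-sided results be applied to the inverse bijection: for the second inequality of
  dimensions, and for excluding a line on either side.\<close>

lemma permutation_iso_sym: "permutation_iso s2 L2 s1 L1 (inv_into (Gr1 s1) \<beta>)"
proof
  let ?i = "inv_into (Gr1 s1) \<beta>"
  show "bij_betw ?i (Gr1 s2) (Gr1 s1)" using bij by (rule bij_betw_inv_into)
  have i: "?i (\<beta> p) = p" if "p \<in> Gr1 s1" for p using bij that by (rule bij_betw_inv_into_left)
  have *: "\<forall>q\<in>Gr1 s2. ?i (h ` q) = g ` ?i q"
    if "g \<in> L1" "\<forall>p\<in>Gr1 s1. \<beta> (g ` p) = h ` \<beta> p" for g h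
  proof
    fix q assume "q \<in> Gr1 s2"
    then obtain p where p: "p \<in> Gr1 s1" "\<beta> p = q" using \<beta>_surj by blast
    then have "?i (h ` q) = ?i (\<beta> (g ` p))" using that by simp
    also have "\<dots> = g ` p" by (rule i[OF V1.image_Gr1[OF that(1) p(1)]])
    finally show "?i (h ` q) = g ` ?i q" using p i by auto
  qed
  show "\<exists>g\<in>L1. \<forall>q\<in>Gr1 s2. ?i (h ` q) = g ` ?i q" if "h \<in> L2" for h
    using conj'[OF that] *[of _ h] by metis
  show "\<exists>h\<in>L2. \<forall>q\<in>Gr1 s2. ?i (h ` q) = g ` ?i q" if "g \<in> L1" for g
    using conj[OF that] *[OF that] by metis
qed

text \<open>
  As the noncollinear triples form one orbit, \<open>\<beta>\<close> either preserves noncollinearity or makes all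
  of them collinear.
\<close>

lemma noncollinear_transfer:
  assumes nc: "noncollinear s1 p q r" "noncollinear s2 (\<beta> p) (\<beta> q) (\<beta> r)"
    and x: "x \<in> Gr1 s1" "y \<in> Gr1 s1" "z \<in> Gr1 s1"
  shows "noncollinear s2 (\<beta> x) (\<beta> y) (\<beta> z) \<longleftrightarrow> noncollinear s1 x y z"
proof
  note Gr = nc(1)[unfolded noncollinear_def]
  assume "noncollinear s2 (\<beta> x) (\<beta> y) (\<beta> z)"
  then obtain h where h: "h \<in> L2" "h ` \<beta> p = \<beta> x" "h ` \<beta> q = \<beta> y" "h ` \<beta> r = \<beta> z"
    using V2.transitive_noncollinear[OF nc(2)] by blast
  obtain g where g: "g \<in> L1" "\<forall>p\<in>Gr1 s1. \<beta> (g ` p) = h ` \<beta> p"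
    using conj'[OF h(1)] by blast
  have pqr: "p \<in> Gr1 s1" "q \<in> Gr1 s1" "r \<in> Gr1 s1" using Gr by auto
  have "\<beta> (g ` p) = \<beta> x" "\<beta> (g ` q) = \<beta> y" "\<beta> (g ` r) = \<beta> z"
    using bspec[OF g(2) pqr(1)] bspec[OF g(2) pqr(2)] bspec[OF g(2) pqr(3)] h(2-4) by (simp_all only:)
  then have "g ` p = x" "g ` q = y" "g ` r = z"
    using inj V1.image_Gr1[OF g(1)] pqr x by simp_all
  then show "noncollinear s1 x y z" using V1.noncollinear_image[OF g(1) nc(1)] by simp
next
  note Gr = nc(1)[unfolded noncollinear_def]
  assume "noncollinear s1 x y z"
  then obtain g where g: "g \<in> L1" "g ` p = x" "g ` q = y" "g ` r = z"
    using V1.transitive_noncollinear[OF nc(1)] by blast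
  obtain h where h: "h \<in> L2" "\<forall>p\<in>Gr1 s1. \<beta> (g ` p) = h ` \<beta> p"
    using conj[OF g(1)] by blast
  have "h ` \<beta> p = \<beta> x" "h ` \<beta> q = \<beta> y" "h ` \<beta> r = \<beta> z"
    using h(2) Gr unfolding g(2-4)[symmetric] by simp_all
  then show "noncollinear s2 (\<beta> x) (\<beta> y) (\<beta> z)"
    using V2.noncollinear_image[OF h(1) nc(2)] by simp
qed

end

section \<open>Isomorphisms between spaces of dimension at least 3\<close>

lemma (in right_vector_space) noncollinear_exists:
  assumes "\<And>x y. right_span s {x, y} \<noteq> UNIV" "p \<in> Gr1 s" "q \<in> Gr1 s"
  shows "\<exists>r\<in>Gr1 s. \<not> r \<subseteq> right_span s (p \<union> q)"
proof -
  obtain x y where "p = pt s x" "q = pt s y" using assms by (metis Gr1E)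
  moreover obtain z where z: "z \<notin> right_span s {x, y}" using assms(1) by blast
  moreover have "z \<noteq> 0" using z subspace_0[OF subspace_span] by metis
  ultimately show ?thesis
    by (intro bexI[of _ "pt s z"]) (auto simp: span_Un_pt pt_subset_iff[OF subspace_span])
qed

lemma (in right_vector_space) other_point_exists:
  assumes "\<And>x y. right_span s {x, y} \<noteq> UNIV" "p \<in> Gr1 s"
  shows "\<exists>q\<in>Gr1 s. p \<noteq> q"
  using noncollinear_exists[OF assms(1,2,2)] span_superset[of p] by auto

context permutation_iso
begin

text \<open>Otherwise noncollinear images would come from collinear points only. If
  \<open>p\<close>, \<open>q\<close>, \<open>r\<close> have noncollinear images, then
  \<open>r\<close> is on the line through \<open>p\<close> and \<open>q\<close>. So is any other
  point \<open>t\<close>: if \<open>\<beta> t\<close> is off the line through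
  \<open>\<beta> p\<close> and \<open>\<beta> q\<close>, use the triple \<open>p\<close>,
  \<open>q\<close>, \<open>t\<close>; if it is on that line and \<open>t\<close> is not
  \<open>p\<close>, use \<open>p\<close>, \<open>r\<close>, \<open>t\<close>.\<close>

lemma noncollinear_preserved_exists:
  assumes np1: "\<And>x y. right_span s1 {x, y} \<noteq> UNIV" and np2: "\<And>x y. right_span s2 {x, y} \<noteq> UNIV"
  shows "\<exists>p q r. noncollinear s1 p q r \<and> noncollinear s2 (\<beta> p) (\<beta> q) (\<beta> r)"
proof (rule ccontr)
  assume no: "\<not> ?thesis"
  have col: "z \<subseteq> right_span s1 (x \<union> y)"
    if "x \<in> Gr1 s1" "y \<in> Gr1 s1" "z \<in> Gr1 s1" "noncollinear s2 (\<beta> x) (\<beta> y) (\<beta> z)" for x y z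
  proof -
    have "x \<noteq> y" using that(4) by (auto simp: noncollinear_def)
    then show ?thesis using no that by (auto simp: noncollinear_def)
  qed
  obtain v where v: "v \<notin> right_span s1 {0, 0}" using np1 by blast
  then have "v \<noteq> 0" by (auto simp: V1.span_sing)
  define p where "p = pt s1 v"
  have p: "p \<in> Gr1 s1" using \<open>v \<noteq> 0\<close> by (simp add: p_def)
  obtain q where q: "q \<in> Gr1 s1" "p \<noteq> q" using V1.other_point_exists[OF np1 p] by blast
  have pq: "\<beta> p \<noteq> \<beta> q" using inj p q by simp
  obtain r where r: "r \<in> Gr1 s1" "\<not> \<beta> r \<subseteq> right_span s2 (\<beta> p \<union> \<beta> q)"
    using V2.noncollinear_exists[OF np2, of "\<beta> p" "\<beta> q"] p q \<beta>_Gr1 \<beta>_surj by metis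
  have nc: "noncollinear s2 (\<beta> p) (\<beta> q) (\<beta> r)" using p q r pq \<beta>_Gr1 by (simp add: noncollinear_def)
  let ?U = "right_span s1 (p \<union> q)"
  note sp = V1.subspace_span[of "p \<union> q"]
  have rU: "r \<subseteq> ?U" using col[OF p q(1) r(1) nc] .
  have pU: "p \<subseteq> ?U" using V1.span_superset[of "p \<union> q"] by blast
  have all: "t \<subseteq> ?U" if t: "t \<in> Gr1 s1" for t
  proof (cases "\<beta> t \<subseteq> right_span s2 (\<beta> p \<union> \<beta> q)")
    case False
    then have "noncollinear s2 (\<beta> p) (\<beta> q) (\<beta> t)" using p q t pq \<beta>_Gr1 by (simp add: noncollinear_def)
    then show ?thesis using col p q t by blast
  next
    case True
    show ?thesis
    proof (cases "t = p")
      case tp: False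
      have "\<not> \<beta> r \<subseteq> right_span s2 (\<beta> p \<union> \<beta> t)"
      proof -
        have "\<beta> p \<union> \<beta> t \<subseteq> right_span s2 (\<beta> p \<union> \<beta> q)"
          using True V2.span_superset[of "\<beta> p \<union> \<beta> q"] by blast
        then have "right_span s2 (\<beta> p \<union> \<beta> t) \<subseteq> right_span s2 (\<beta> p \<union> \<beta> q)"
          by (rule V2.span_minimal[OF _ V2.subspace_span])
        then show ?thesis using r by blast
      qed
      moreover obtain x y z where xyz: "\<beta> p = pt s2 x" "\<beta> t = pt s2 y" "\<beta> r = pt s2 z"
        "x \<noteq> 0" "y \<noteq> 0" "z \<noteq> 0"
        using p t r \<beta>_Gr1 by (metis V2.Gr1E)
      moreover have "\<beta> p \<noteq> \<beta> t" using inj p t tp by auto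
      ultimately have z: "z \<notin> right_span s2 {x, y}" and y: "y \<notin> right_span s2 {x}"
        using V2.pt_eqI[of y x] by (auto simp: V2.span_Un_pt V2.pt_subset_iff[OF V2.subspace_span] V2.span_sing)
      have "y \<notin> right_span s2 {z, x}"
        using V2.span_exchange[of y z "{x}"] y z by (auto simp: insert_commute)
      then have "\<not> \<beta> t \<subseteq> right_span s2 (\<beta> p \<union> \<beta> r)"
        using xyz by (simp add: V2.span_Un_pt V2.pt_subset_iff[OF V2.subspace_span] insert_commute)
      moreover have "\<beta> p \<noteq> \<beta> r"
        using r V2.span_superset[of "\<beta> p \<union> \<beta> q"] by auto
      ultimately have "noncollinear s2 (\<beta> p) (\<beta> r) (\<beta> t)"
        using p r t \<beta>_Gr1 by (simp add: noncollinear_def)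
      then have "t \<subseteq> right_span s1 (p \<union> r)" using col p r t by blast
      also have "\<dots> \<subseteq> ?U" using pU rU by (intro V1.span_minimal[OF _ sp]) blast
      finally show ?thesis .
    qed (use pU in simp)
  qed
  show False using V1.noncollinear_exists[OF np1 p q(1)] all by blast
qed

lemma semilinear_if_not_planes:
  assumes np1: "\<And>x y. right_span s1 {x, y} \<noteq> UNIV" and np2: "\<And>x y. right_span s2 {x, y} \<noteq> UNIV"
  shows "\<exists>F. semilinear_iso s1 s2 F \<and> induced_by_semilinear s1 \<beta> F"
proof -
  obtain p q r where nc: "noncollinear s1 p q r" "noncollinear s2 (\<beta> p) (\<beta> q) (\<beta> r)"
    using noncollinear_preserved_exists[OF assms] by blast
  interpret collineation s1 s2 \<beta>
  proof
    fix x y z assume "x \<in> Gr1 s1" "y \<in> Gr1 s1" "z \<in> Gr1 s1" "x \<noteq> y"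
    then show "\<beta> z \<subseteq> right_span s2 (\<beta> x \<union> \<beta> y) \<longleftrightarrow> z \<subseteq> right_span s1 (x \<union> y)"
      using noncollinear_transfer[OF nc, of x y z] inj[of x y] \<beta>_Gr1 by (auto simp: noncollinear_def)
  qed (use bij np1 in auto)
  show ?thesis by (rule fundamental_theorem)
qed

end

text \<open>The image of a spanning set spans. The reverse inequality comes from a semilinear
  isomorphism in the other direction.\<close>

lemma semilinear_iso_dim:
  assumes "right_vector_space s1" "right_vector_space s2" "semilinear_iso s1 s2 F"
    "has_finite_dim s1 UNIV n1" "has_finite_dim s2 UNIV n2"
  shows "n2 \<le> n1"
proof -
  interpret V1: right_vector_space s1 by fact
  interpret V2: right_vector_space s2 by fact
  obtain \<theta> where F: "bij F" "\<And>v w. F (v + w) = F v + F w" "\<And>v a. F (s1 v a) = s2 (F v) (\<theta> a)"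
    "skew_field_iso \<theta>"
    using assms(3) by (auto simp: semilinear_iso_def)
  obtain B where B: "right_span s1 B = UNIV" "finite B" "card B = n1"
    using assms(4) by (auto simp: has_finite_dim_def right_base_def)
  let ?U = "F -` right_span s2 (F ` B)"
  have F0: "F 0 = 0" using F(2)[of 0 0] by simp
  have "right_subspace s1 ?U"
    unfolding right_subspace_def
    using V2.subspace_0[OF V2.subspace_span] V2.subspace_add[OF V2.subspace_span]
      V2.subspace_scale[OF V2.subspace_span] by (simp add: F F0)
  moreover have "B \<subseteq> ?U" using V2.span_superset[of "F ` B"] by blast
  ultimately have "?U = UNIV" using V1.span_minimal[of B ?U] B(1) by auto
  then have "right_span s2 (F ` B) = UNIV"
    using F(1) by (metis bij_is_surj surj_image_vimage_eq)
  then have "n2 \<le> card (F ` B)" using V2.finite_dim_le assms(5) B(2) by blast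
  then show ?thesis using card_image_le[OF B(2), of F] B(3) by simp
qed

section \<open>The projective line\<close>

subsection \<open>Hua's theorem\<close>

text \<open>With \<open>y = inverse x - a\<close> the sum of the inverses factors as
  \<open>inverse a * (y + a) * inverse y\<close>, whose middle factor is \<open>inverse x\<close>.
  The identity expresses \<open>a * x * a\<close> by additions, subtractions and inversions
  alone.\<close>

lemma hua_identity:
  fixes a x :: "'d::division_ring"
  assumes "a \<noteq> 0" "x \<noteq> 0" "inverse x \<noteq> a"
  shows "inverse a + inverse (inverse x - a) \<noteq> 0"
    and "a - inverse (inverse a + inverse (inverse x - a)) = a * x * a"
proof -
  define y where "y = inverse x - a"
  have y: "y \<noteq> 0" "y + a = inverse x" using assms by (auto simp: y_def)
  have "inverse a + inverse y = inverse a * (y + a) * inverse y"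
    using assms y(1) by (simp add: distrib_left distrib_right mult.assoc)
  then have eq: "inverse a + inverse y = inverse a * inverse x * inverse y" using y by simp
  then show "inverse a + inverse (inverse x - a) \<noteq> 0"
    using assms y by (simp add: y_def[symmetric])
  have "inverse (inverse a + inverse y) = y * (x * a)"
    unfolding eq using assms y by (simp add: nonzero_inverse_mult_distrib mult.assoc)
  also have "\<dots> = a - a * x * a"
    using assms by (simp add: y_def left_diff_distrib mult.assoc[symmetric])
  finally show "a - inverse (inverse a + inverse (inverse x - a)) = a * x * a"
    by (simp add: y_def)
qed

text \<open>Write \<open>\<psi> x\<close> for \<open>inverse (\<theta> (inverse x))\<close>. Since
  \<open>\<theta>\<close> and \<open>\<psi>\<close> are both additive, applying
  \<open>\<theta>\<close> to Hua's identity gives \<open>\<theta> a * \<psi> x * \<theta> a\<close>.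
  Putting \<open>a = 1\<close> shows \<open>\<psi> = \<theta>\<close>, so compatibility with
  inverses is a result rather than an assumption.\<close>

lemma hua_sandwich:
  fixes \<theta> :: "'d::division_ring \<Rightarrow> 'e::division_ring"
  assumes add: "\<And>x y. \<theta> (x + y) = \<theta> x + \<theta> y" and one: "\<theta> 1 = 1" and inj: "inj \<theta>"
    and inv_add: "\<And>x y. inverse (\<theta> (inverse (x + y)))
      = inverse (\<theta> (inverse x)) + inverse (\<theta> (inverse y))"
  shows "\<theta> (inverse x) = inverse (\<theta> x)" and "\<theta> (a * x * a) = \<theta> a * \<theta> x * \<theta> a"
proof -
  have zero: "\<theta> 0 = 0" using add[of 0 0] by simp
  have diff: "\<theta> (x - y) = \<theta> x - \<theta> y" for x y using add[of "x - y" y] by simp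
  have nz: "\<theta> x = 0 \<longleftrightarrow> x = 0" for x using inj zero by (metis injD)
  have *: "\<theta> (a * x * a) = \<theta> a * inverse (\<theta> (inverse x)) * \<theta> a"
    if a: "a \<noteq> 0" "x \<noteq> 0" "inverse x \<noteq> a" for a x
  proof -
    have "inverse (\<theta> (inverse (inverse a + inverse (inverse x - a))))
        = inverse (\<theta> a) + inverse (\<theta> (inverse x) - \<theta> a)"
      by (simp add: inv_add diff)
    then have "\<theta> (inverse (inverse a + inverse (inverse x - a)))
        = inverse (inverse (\<theta> a) + inverse (\<theta> (inverse x) - \<theta> a))"
      by (metis inverse_inverse_eq)
    then have "\<theta> (a * x * a) = \<theta> a - inverse (inverse (\<theta> a) + inverse (\<theta> (inverse x) - \<theta> a))"
      by (simp add: hua_identity(2)[OF a, symmetric] diff)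
    also have "\<dots> = \<theta> a - inverse (inverse (\<theta> a) +
        inverse (inverse (inverse (\<theta> (inverse x))) - \<theta> a))" by simp
    also have "\<dots> = \<theta> a * inverse (\<theta> (inverse x)) * \<theta> a"
    proof (rule hua_identity(2))
      show "\<theta> a \<noteq> 0" "inverse (\<theta> (inverse x)) \<noteq> 0" using a nz by simp_all
      show "inverse (inverse (\<theta> (inverse x))) \<noteq> \<theta> a" using a(3) inj by (simp add: inj_eq)
    qed
    finally show ?thesis .
  qed
  show inverse: "\<theta> (inverse x) = inverse (\<theta> x)" for x
  \<comment> \<open>Hua's identity with \<open>a = 1\<close> excludes exactly these
    \<open>x\<close>; the convention \<open>inverse 0 = 0\<close> settles the first.\<close>
  proof (cases "x = 0 \<or> x = 1")
    case False
    then have "inverse x \<noteq> 1" by (metis inverse_1 inverse_inverse_eq)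
    then show ?thesis using *[of 1 x] False one by simp
  qed (use zero one in auto)
  show "\<theta> (a * x * a) = \<theta> a * \<theta> x * \<theta> a"
  proof (cases "a = 0 \<or> x = 0")
    case False
    show ?thesis
    proof (cases "a = inverse x")
      case True
      then have "a * x = 1" "\<theta> a * \<theta> x = 1" using False by (simp_all add: inverse nz)
      then show ?thesis by simp
    next
      case ne: False
      then show ?thesis using *[of a x] False by (simp add: inverse)
    qed
  qed (auto simp: zero)
qed

text \<open>
  With \<open>c = \<theta> (a b)\<close>, \<open>u = \<theta> a\<close>, \<open>v = \<theta> b\<close>, the product \<open>(c - u v) c\<^sup>-\<^sup>1 (c - v u)\<close> vanishes, so
  pointwise \<open>\<theta>\<close> is multiplicative or antimultiplicative; a group is not the union of two proper
  subgroups, which makes the alternative global.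
\<close>

lemma hua_theorem:
  fixes \<theta> :: "'d::division_ring \<Rightarrow> 'e::division_ring"
  assumes add: "\<And>x y. \<theta> (x + y) = \<theta> x + \<theta> y" and one: "\<theta> 1 = 1" and inj: "inj \<theta>"
    and inverse: "\<And>x. \<theta> (inverse x) = inverse (\<theta> x)"
    and sandwich: "\<And>a x. \<theta> (a * x * a) = \<theta> a * \<theta> x * \<theta> a"
  shows "(\<forall>x y. \<theta> (x * y) = \<theta> x * \<theta> y) \<or> (\<forall>x y. \<theta> (x * y) = \<theta> y * \<theta> x)"
proof -
  have zero: "\<theta> 0 = 0" using add[of 0 0] by simp
  have nz: "\<theta> x = 0 \<longleftrightarrow> x = 0" for x using inj zero by (metis injD)
  \<comment> \<open>The sandwich law, polarised at \<open>a + 1\<close>.\<close>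
  have jordan: "\<theta> (a * b) + \<theta> (b * a) = \<theta> a * \<theta> b + \<theta> b * \<theta> a" for a b
  proof -
    have "\<theta> ((a + 1) * b * (a + 1)) = \<theta> (a * b * a) + \<theta> (a * b) + \<theta> (b * a) + \<theta> b"
      by (simp add: algebra_simps add)
    moreover have "\<theta> ((a + 1) * b * (a + 1)) = (\<theta> a + 1) * \<theta> b * (\<theta> a + 1)"
      by (simp only: sandwich add one)
    ultimately show ?thesis by (simp add: sandwich) (simp add: algebra_simps)
  qed
  have or: "\<theta> (a * b) = \<theta> a * \<theta> b \<or> \<theta> (a * b) = \<theta> b * \<theta> a" for a b
  proof (cases "a = 0 \<or> b = 0")
    case True then show ?thesis by (auto simp: zero)
  next
    case False
    define c u v where "c = \<theta> (a * b)" and "u = \<theta> a" and "v = \<theta> b"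
    have c: "c \<noteq> 0" using False nz by (simp add: c_def)
    \<comment> \<open>The argument is chosen so that the two nested sandwiches collapse to
      \<open>b * a\<close>.\<close>
    have "u * (v * inverse c * v) * u = \<theta> (a * (b * inverse (a * b) * b) * a)"
      by (simp only: sandwich inverse c_def u_def v_def)
    also have "a * (b * inverse (a * b) * b) * a = b * a"
      using False by (simp add: nonzero_inverse_mult_distrib mult.assoc[symmetric])
    finally have ba: "u * v * inverse c * (v * u) = \<theta> (b * a)" by (simp add: mult.assoc)
    have "(c - u * v) * inverse c * (c - v * u)
        = c - u * v - v * u + u * v * inverse c * (v * u)"
      using c by (simp add: algebra_simps)
    also have "\<dots> = 0" using jordan[of a b] ba by (simp add: c_def u_def v_def algebra_simps)
    finally have "c - u * v = 0 \<or> c - v * u = 0" using c by simp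
    then show ?thesis by (simp add: c_def u_def v_def)
  qed
  have row: "(\<forall>b. \<theta> (a * b) = \<theta> a * \<theta> b) \<or> (\<forall>b. \<theta> (a * b) = \<theta> b * \<theta> a)" for a
  proof (rule ccontr)
    assume "\<not> ?thesis"
    then obtain b c where "\<theta> (a * b) \<noteq> \<theta> a * \<theta> b" "\<theta> (a * c) \<noteq> \<theta> c * \<theta> a" by blast
    moreover have "\<theta> (a * (b + c)) = \<theta> (a * b) + \<theta> (a * c)" by (simp add: distrib_left add)
    ultimately show False
      using or[of a b] or[of a c] or[of a "b + c"] by (auto simp: add distrib_left distrib_right)
  qed
  show ?thesis
  proof (rule ccontr)
    assume "\<not> ?thesis"
    then obtain a b c d where ab: "\<theta> (a * b) \<noteq> \<theta> a * \<theta> b" and cd: "\<theta> (c * d) \<noteq> \<theta> d * \<theta> c" by blast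
    have a: "\<theta> (a * y) = \<theta> y * \<theta> a" for y using row[of a] ab by blast
    have c: "\<theta> (c * y) = \<theta> c * \<theta> y" for y using row[of c] cd by blast
    have ac: "\<theta> ((a + c) * y) = \<theta> y * \<theta> a + \<theta> c * \<theta> y" for y
      by (simp add: distrib_right add a c)
    from row[of "a + c"] show False
    proof
      assume "\<forall>y. \<theta> ((a + c) * y) = \<theta> (a + c) * \<theta> y"
      then have "\<theta> b * \<theta> a = \<theta> a * \<theta> b" using ac[of b] by (simp add: add distrib_right)
      then show False using ab a[of b] by simp
    next
      assume "\<forall>y. \<theta> ((a + c) * y) = \<theta> y * \<theta> (a + c)"
      then have "\<theta> c * \<theta> d = \<theta> d * \<theta> c" using ac[of d] by (simp add: add distrib_left)
      then show False using cd c[of d] by simp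
    qed
  qed
qed

subsection \<open>Permutation groups of the projective line\<close>

text \<open>The commutators \<open>u\<close>, \<open>u'\<close> of \<open>z\<close> with
  \<open>x\<close> and \<open>1 + x\<close> commute with \<open>z\<close> and satisfy
  \<open>(u - u') * x = u' - 1\<close>. If they differ, \<open>x\<close> is a quotient of elements
  commuting with \<open>z\<close>, so it commutes with \<open>z\<close> too; if they agree, both are
  1. This is an argument of Cartan-Brauer-Hua type.\<close>

lemma central_if_commutes_with_commutators:
  fixes z :: "'d::division_ring"
  assumes "\<And>a b. a \<noteq> 0 \<Longrightarrow> b \<noteq> 0 \<Longrightarrow>
    z * (a * b * inverse (b * a)) = a * b * inverse (b * a) * z"
  shows "z * x = x * z"
proof (rule ccontr)
  assume ne: "z * x \<noteq> x * z"
  then have nz: "z \<noteq> 0" "x \<noteq> 0" by auto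
  have nz1: "1 + x \<noteq> 0"
  proof
    assume "1 + x = 0"
    then have "x = - 1" by (simp add: add_eq_0_iff)
    then show False using ne by simp
  qed
  define u u' where "u = z * x * inverse (x * z)" and "u' = z * (1 + x) * inverse ((1 + x) * z)"
  have u: "z * u = u * z" "z * u' = u' * z"
    unfolding u_def u'_def using assms nz nz1 by blast+
  have 1: "u * (x * z) = z * x" unfolding u_def using nz by (simp only: mult.assoc) simp
  have 2: "u' * ((1 + x) * z) = z * (1 + x)"
    unfolding u'_def using nz nz1 by (simp only: mult.assoc) simp
  have "(u' + u' * x) * z = (1 + u * x) * z" using 1 2 by (simp add: algebra_simps)
  then have "u' + u' * x = 1 + u * x" using nz by simp
  then have eq: "(u - u') * x = u' - 1" by (simp add: algebra_simps)
  show False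
  proof (cases "u = u'")
    case True
    then have "u = 1" using eq by simp
    then show False using 1 ne by simp
  next
    case False
    have "(u - u') * z = z * (u - u')" using u by (simp add: algebra_simps)
    then have "(u - u') * (z * x) = z * ((u - u') * x)" by (metis mult.assoc)
    also have "\<dots> = (u - u') * x * z" unfolding eq using u by (simp add: algebra_simps)
    finally have "(u - u') * (z * x) = (u - u') * (x * z)" by (simp add: mult.assoc)
    then show False using False ne by simp
  qed
qed

text \<open>
  If some \<open>\<tau> d\<close> were no translation, its commutator with a suitable translation would be a translation
  by some \<open>w \<noteq> 0\<close> in the range of \<open>\<tau>\<close>; as this range is abelian, \<open>a w k b = w k\<close> for all commutators
  \<open>k\<close>, so that \<open>b\<close> is central and \<open>a = b\<^sup>-\<^sup>1\<close>, a contradiction.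
\<close>

lemma abelian_affine_group_translations:
  fixes \<tau> :: "'a::ab_group_add \<Rightarrow> 'd::division_ring \<Rightarrow> 'd"
  assumes comp: "\<And>c d y. \<tau> c (\<tau> d y) = \<tau> (c + d) y" and zero: "\<And>y. \<tau> 0 y = y"
    and affine: "\<And>d. \<exists>a b c. a \<noteq> 0 \<and> b \<noteq> 0 \<and> (\<forall>y. \<tau> d y = a * y * b + c)"
    and normal_add: "\<And>d e. \<exists>d'. \<forall>y. \<tau> d' (y + e) = \<tau> d y + e"
    and normal_mult: "\<And>d a b. a \<noteq> 0 \<Longrightarrow> b \<noteq> 0 \<Longrightarrow>
      \<exists>d'. \<forall>y. \<tau> d' (y * (a * b * inverse (b * a))) = \<tau> d y * (a * b * inverse (b * a))"
  shows "\<tau> d y = y + \<tau> d 0"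
proof -
  obtain a b c where ab: "a \<noteq> 0" "b \<noteq> 0" and \<tau>: "\<And>y. \<tau> d y = a * y * b + c"
    using affine[of d] by blast
  have comm: "a * w * b = w" if "\<And>y. \<tau> d0 y = y + w" for d0 w
  proof -
    have "\<tau> d0 (\<tau> d 0) = \<tau> d (\<tau> d0 0)" by (simp add: comp add.commute)
    then show ?thesis by (simp add: that \<tau> algebra_simps)
  qed
  have "a * e * b = e" for e
  proof (rule ccontr)
    assume ne: "a * e * b \<noteq> e"
    obtain d' where d': "\<And>y. \<tau> d' (y + e) = \<tau> d y + e" using normal_add by blast
    define w where "w = e - a * e * b"
    have w: "w \<noteq> 0" using ne by (simp add: w_def)
    have d'': "\<tau> d' y = \<tau> d y + w" for y
      using d'[of "y - e"] by (simp add: \<tau> w_def algebra_simps)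
    have trans: "\<tau> (d' - d) y = y + w" for y
    proof -
      have "\<tau> (d' - d) y = \<tau> d' (\<tau> (- d) y)" by (simp add: comp)
      also have "\<dots> = \<tau> d (\<tau> (- d) y) + w" by (rule d'')
      finally show ?thesis by (simp add: comp zero)
    qed
    have awb: "a * w * b = w" using comm[OF trans] .
    have central: "b * x = x * b" for x
    proof (rule central_if_commutes_with_commutators)
      fix p q :: 'd assume pq: "p \<noteq> 0" "q \<noteq> 0"
      define k where "k = p * q * inverse (q * p)"
      have k: "k \<noteq> 0" using pq by (simp add: k_def)
      obtain d1 where d1: "\<And>y. \<tau> d1 (y * k) = \<tau> (d' - d) y * k"
        using normal_mult[OF pq] unfolding k_def by blast
      have "\<tau> d1 y = y + w * k" for y
      proof -
        have "\<tau> d1 y = \<tau> d1 (y * inverse k * k)" using k by (simp add: mult.assoc)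
        also have "\<dots> = (y * inverse k + w) * k" by (simp only: d1 trans)
        finally show ?thesis using k by (simp add: distrib_right mult.assoc)
      qed
      then have "a * (w * k) * b = w * k" by (rule comm)
      then have "a * w * (k * b) = a * w * (b * k)" using awb by (metis mult.assoc)
      then show "b * k = k * b" using ab w by simp
    qed
    have "(a * b) * w = 1 * w" using awb central[of w] by (simp add: mult.assoc)
    then have "a * b = 1" using w mult_right_cancel by blast
    then have "a * e * b = e" using central[of e] by (metis mult.assoc mult_1)
    then show False using ne by simp
  qed
  then show ?thesis by (simp add: \<tau>)
qed

section \<open>Permutation groups in the affine coordinate\<close>

definition shift :: "'d::division_ring \<Rightarrow> 'd option \<Rightarrow> 'd option"
  where "shift a = map_option (\<lambda>x. x + a)"

text \<open>With the sign, this map is induced by a product of three transvections.\<close>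

definition neg_inverse :: "'d::division_ring option \<Rightarrow> 'd option"
  where "neg_inverse z =
    (case z of None \<Rightarrow> Some 0 | Some x \<Rightarrow> if x = 0 then None else Some (- inverse x))"

lemma shift_simps [simp]: "shift a None = None" "shift a (Some x) = Some (x + a)"
  by (auto simp: shift_def)

lemma neg_inverse_simps [simp]: "neg_inverse None = Some 0" "neg_inverse (Some 0) = None"
  "x \<noteq> 0 \<Longrightarrow> neg_inverse (Some x) = Some (- inverse x)"
  by (auto simp: neg_inverse_def)

locale projective_line_group =
  fixes G :: "('d::division_ring option \<Rightarrow> 'd option) set"
  assumes comp_G: "g \<in> G \<Longrightarrow> h \<in> G \<Longrightarrow> g \<circ> h \<in> G"
    and shift_G: "shift a \<in> G"
    and neg_inverse_G: "neg_inverse \<in> G"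
    and affine_G: "g \<in> G \<Longrightarrow> g None = None \<Longrightarrow>
      \<exists>a b c. a \<noteq> 0 \<and> b \<noteq> 0 \<and> (\<forall>x. g (Some x) = Some (a * x * b + c))"
begin

text \<open>Read from right to left, the composite evaluates Hua's identity one operation at a
  time.\<close>

lemma sandwich_G: "a \<noteq> 0 \<Longrightarrow> map_option (\<lambda>x. a * x * a) \<in> G"
proof -
  assume a: "a \<noteq> 0"
  let ?g = "shift a \<circ> (neg_inverse \<circ> (shift (inverse a) \<circ> (neg_inverse \<circ> (shift a \<circ> neg_inverse))))"
  have "?g z = map_option (\<lambda>x. a * x * a) z" for z
  proof (cases z)
    case None
    then show ?thesis using a by simp
  next
    case (Some x)
    \<comment> \<open>For the first two kinds of \<open>x\<close> the composite passes through
      infinity on the way.\<close>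
    consider "x = 0" | "x \<noteq> 0" "inverse x = a" | "x \<noteq> 0" "inverse x \<noteq> a" by blast
    then show ?thesis
    proof cases
      case 1
      then show ?thesis using a Some by simp
    next
      case 2
      then have "a * x = 1" by (metis left_inverse)
      then show ?thesis using 2 Some by simp
    next
      case 3
      define y where "y = inverse x - a"
      have y: "- inverse x + a = - y" "y \<noteq> 0" using 3 by (simp_all add: y_def)
      have "inverse y + inverse a \<noteq> 0" "- inverse (inverse y + inverse a) + a = a * x * a"
        using hua_identity[OF a 3] by (simp_all add: y_def add.commute)
      then show ?thesis using 3(1) y by (simp add: Some)
    qed
  qed
  then have "map_option (\<lambda>x. a * x * a) = ?g" by auto
  moreover have "?g \<in> G" by (intro comp_G shift_G neg_inverse_G)
  ultimately show ?thesis by simp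
qed

text \<open>Sandwiching by \<open>a\<close>, by \<open>b\<close> and by
  \<open>inverse (b * a)\<close> cancels all factors on the left. The right multiplications obtained
  fix infinity and will normalise the transported translations.\<close>

lemma commutator_G:
  assumes "a \<noteq> 0" "b \<noteq> 0"
  shows "map_option (\<lambda>x. x * (a * b * inverse (b * a))) \<in> G"
proof -
  let ?s = "\<lambda>c. map_option (\<lambda>x. c * x * c)"
  have "inverse (b * a) * (b * (a * x * a) * b) * inverse (b * a) = x * (a * b * inverse (b * a))" for x
    using assms by (simp add: nonzero_inverse_mult_distrib mult.assoc) (simp add: mult.assoc[symmetric])
  then have "map_option (\<lambda>x. x * (a * b * inverse (b * a))) = ?s (inverse (b * a)) \<circ> (?s b \<circ> ?s a)"
    by (simp add: option.map_comp comp_def)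
  also have "\<dots> \<in> G" using assms by (intro comp_G sandwich_G) auto
  finally show ?thesis .
qed

end

section \<open>Isomorphisms normalised at 0, 1 and infinity\<close>

locale projective_line_iso =
  G1: projective_line_group G1 + G2: projective_line_group G2
  for G1 :: "('d::division_ring option \<Rightarrow> 'd option) set"
    and G2 :: "('e::division_ring option \<Rightarrow> 'e option) set" +
  fixes \<beta> :: "'d option \<Rightarrow> 'e option"
  assumes bij: "bij \<beta>"
    and None: "\<beta> None = None" and zero: "\<beta> (Some 0) = Some 0" and one: "\<beta> (Some 1) = Some 1"
    and conj: "g \<in> G1 \<Longrightarrow> \<exists>h\<in>G2. \<forall>z. \<beta> (g z) = h (\<beta> z)"
    and conj': "h \<in> G2 \<Longrightarrow> \<exists>g\<in>G1. \<forall>z. \<beta> (g z) = h (\<beta> z)"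
begin

definition \<theta> where "\<theta> x = the (\<beta> (Some x))"

lemma \<beta>_Some: "\<beta> (Some x) = Some (\<theta> x)"
proof -
  have "\<beta> (Some x) \<noteq> None" using bij None by (metis bij_pointE option.distinct(1))
  then show ?thesis by (simp add: \<theta>_def)
qed

lemma \<beta>_eq: "\<beta> = map_option \<theta>"
proof
  show "\<beta> z = map_option \<theta> z" for z by (cases z) (simp_all add: None \<beta>_Some)
qed

lemma \<theta>_0: "\<theta> 0 = 0" and \<theta>_1: "\<theta> 1 = 1"
  using zero one by (simp_all add: \<theta>_def)

lemma bij_\<theta>: "bij \<theta>"
proof (rule bijI)
  show "inj \<theta>"
  proof (rule injI)
    fix x y assume "\<theta> x = \<theta> y"
    then have "\<beta> (Some x) = \<beta> (Some y)" by (simp add: \<beta>_Some)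
    then show "x = y" using bij by (metis bij_pointE option.inject)
  qed
  show "surj \<theta>"
    unfolding surj_def
  proof
    fix y
    obtain z where z: "\<beta> z = Some y" using bij by (metis bij_pointE)
    then show "\<exists>x. y = \<theta> x" by (cases z) (auto simp: None \<beta>_Some)
  qed
qed

text \<open>The counterpart of \<open>h\<close> in \<open>G1\<close> is some
  \<open>a * x * b + c\<close>, which turns a shift by \<open>d\<close> into a shift by
  \<open>a * d * b\<close>.\<close>

lemma stabilizer_normalizes:
  assumes "h \<in> G2" "h None = None"
  shows "\<exists>d'. \<forall>x. h (Some (\<theta> (x + d))) = map_option (\<lambda>y. \<theta> (inv_into UNIV \<theta> y + d')) (h (Some (\<theta> x)))"
proof -
  obtain g where g: "g \<in> G1" "\<And>z. \<beta> (g z) = h (\<beta> z)" using conj'[OF assms(1)] by blast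
  have "g None = None" using g(2)[of None] None assms(2) bij by (metis bij_pointE)
  then obtain a b c where g_Some: "\<And>x. g (Some x) = Some (a * x * b + c)"
    using G1.affine_G[OF g(1)] by blast
  have h: "h (Some (\<theta> x)) = Some (\<theta> (a * x * b + c))" for x
    using g(2)[of "Some x"] by (simp add: g_Some \<beta>_Some)
  have "inv_into UNIV \<theta> (\<theta> x) = x" for x using bij_\<theta> by (simp add: bij_is_inj)
  then show ?thesis by (intro exI[of _ "a * d * b"]) (simp add: h algebra_simps)
qed

text \<open>\<open>\<tau> d\<close> is the shift by \<open>d\<close> transported to the second line.
  It is affine there, being given by an element of \<open>G2\<close> that fixes infinity, and the
  maps \<open>\<tau> d\<close> form an abelian group normalised by shifts and by commutator
  multiplications; hence they are translations.\<close>

lemma \<theta>_add: "\<theta> (x + d) = \<theta> x + \<theta> d"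
proof -
  let ?\<eta> = "inv_into UNIV \<theta>"
  have \<eta>: "?\<eta> (\<theta> x) = x" "\<theta> (?\<eta> y) = y" for x y
    using bij_\<theta> by (simp_all add: bij_is_inj bij_is_surj surj_f_inv_f)
  define \<tau> where "\<tau> d y = \<theta> (?\<eta> y + d)" for d y
  have "\<tau> d (\<theta> x) = \<theta> x + \<tau> d 0"
  proof (rule abelian_affine_group_translations)
    show "\<tau> c (\<tau> d y) = \<tau> (c + d) y" for c d y by (simp add: \<tau>_def \<eta> add_ac)
    show "\<tau> 0 y = y" for y by (simp add: \<tau>_def \<eta>)
    show "\<exists>a b c. a \<noteq> 0 \<and> b \<noteq> 0 \<and> (\<forall>y. \<tau> d y = a * y * b + c)" for d
    proof -
      obtain h where h: "h \<in> G2" "\<And>z. \<beta> (shift d z) = h (\<beta> z)" using conj[OF G1.shift_G] by blast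
      have "h None = None" using h(2)[of None] by (simp add: None)
      then obtain a b c where "a \<noteq> 0" "b \<noteq> 0" "\<And>x. h (Some x) = Some (a * x * b + c)"
        using G2.affine_G[OF h(1)] by blast
      moreover have "h (Some y) = Some (\<tau> d y)" for y
        using h(2)[of "Some (?\<eta> y)"] by (simp add: \<beta>_Some \<eta> \<tau>_def)
      ultimately show ?thesis by auto
    qed
    have normal: "\<exists>d'. \<forall>y. \<tau> d' (f y) = f (\<tau> d y)" if f: "map_option f \<in> G2" for f d
    proof -
      obtain d' where "\<And>x. f (\<theta> (x + d)) = \<theta> (?\<eta> (f (\<theta> x)) + d')"
        using stabilizer_normalizes[OF f, of d] by auto
      from this[of "?\<eta> _"] show ?thesis by (intro exI[of _ d']) (simp add: \<tau>_def \<eta>)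
    qed
    show "\<exists>d'. \<forall>y. \<tau> d' (y + e) = \<tau> d y + e" for d e
      using normal[OF G2.shift_G[unfolded shift_def]] .
    show "\<exists>d'. \<forall>y. \<tau> d' (y * (a * b * inverse (b * a))) = \<tau> d y * (a * b * inverse (b * a))"
      if "a \<noteq> 0" "b \<noteq> 0" for d a b
      using normal[OF G2.commutator_G[OF that]] .
  qed
  moreover have "?\<eta> 0 = 0" using \<eta>(1)[of 0] \<theta>_0 by simp
  ultimately show ?thesis by (simp add: \<tau>_def \<eta>)
qed

text \<open>The transported \<open>neg_inverse\<close> swaps 0 and infinity, so composed with
  \<open>neg_inverse\<close> it fixes both and has the form \<open>a * x * b\<close>. Hence
  \<open>\<theta> (inverse x) = a * inverse (\<theta> x) * b\<close>, and inverting gives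
  \<open>inverse b * \<theta> x * inverse a\<close>, which is additive in \<open>x\<close>.\<close>

lemma \<theta>_inverse_add:
  "inverse (\<theta> (inverse (x + y))) = inverse (\<theta> (inverse x)) + inverse (\<theta> (inverse y))"
proof -
  obtain h where h: "h \<in> G2" "\<And>z. \<beta> (neg_inverse z) = h (\<beta> z)"
    using conj[OF G1.neg_inverse_G] by blast
  have swap: "h None = Some 0" "h (Some 0) = None"
    using h(2)[of None] h(2)[of "Some 0"] by (simp_all add: None zero)
  have "h \<circ> neg_inverse \<in> G2" using h(1) G2.neg_inverse_G by (rule G2.comp_G)
  then obtain a b c where ab: "a \<noteq> 0" "b \<noteq> 0"
    and g: "\<And>x. h (neg_inverse (Some x)) = Some (a * x * b + c)"
    using G2.affine_G[of "h \<circ> neg_inverse"] swap by auto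
  have "c = 0" using g[of 0] swap by simp
  have neg: "\<theta> (- x) = - \<theta> x" for x
    using \<theta>_add[of "- x" x] by (simp add: \<theta>_0 eq_neg_iff_add_eq_0)
  have nz: "\<theta> x = 0 \<longleftrightarrow> x = 0" for x using bij_\<theta> \<theta>_0 by (metis bij_pointE)
  have inverse: "\<theta> (inverse x) = a * inverse (\<theta> x) * b" for x
  proof (cases "x = 0")
    case False
    have "neg_inverse (Some (- inverse (\<theta> x))) = Some (\<theta> x)"
      using False by (simp add: nz)
    then have "h (Some (\<theta> x)) = Some (- (a * inverse (\<theta> x) * b))"
      using g[of "- inverse (\<theta> x)"] \<open>c = 0\<close> by simp
    then show ?thesis using h(2)[of "Some x"] False by (simp add: \<beta>_Some neg)
  qed (simp add: \<theta>_0)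
  have "inverse (\<theta> (inverse x)) = inverse b * \<theta> x * inverse a" for x
    using ab by (cases "x = 0") (simp_all add: inverse \<theta>_0 nonzero_inverse_mult_distrib nz mult.assoc)
  then show ?thesis by (simp add: \<theta>_add algebra_simps)
qed

theorem \<theta>_iso_or_anti_iso: "skew_field_iso \<theta> \<or> skew_field_anti_iso \<theta>"
proof -
  have "(\<forall>x y. \<theta> (x * y) = \<theta> x * \<theta> y) \<or> (\<forall>x y. \<theta> (x * y) = \<theta> y * \<theta> x)"
    using hua_theorem[OF \<theta>_add \<theta>_1 bij_is_inj[OF bij_\<theta>]]
      hua_sandwich[OF \<theta>_add \<theta>_1 bij_is_inj[OF bij_\<theta>] \<theta>_inverse_add] by blast
  then show ?thesis
    using \<theta>_add \<theta>_1 bij_\<theta> by (auto simp: skew_field_iso_def skew_field_anti_iso_def)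
qed

end

section \<open>Homogeneous and affine coordinates of a plane\<close>

lemma (in right_vector_space) plane_base:
  assumes "has_finite_dim s UNIV 2" "x \<noteq> 0" "y \<noteq> 0" "pt s x \<noteq> pt s y"
  shows "right_base s UNIV {x, y}"
proof -
  have "x \<noteq> y" using assms(4) by auto
  then have ind: "right_independent s {x, y}"
    using assms pt_eqI[of x y] pt_eqI[of y x] by (auto simp: independent_pair_iff)
  have "z \<in> right_span s {x, y}" for z
  proof (rule ccontr)
    assume z: "z \<notin> right_span s {x, y}"
    then have "z \<noteq> x" "z \<noteq> y" using span_base[of _ "{x, y}"] by auto
    then have card: "card {z, x, y} = 3" using \<open>x \<noteq> y\<close> by simp
    obtain B where "right_span s B = UNIV" "finite B" "card B = 2"
      using assms(1) by (auto simp: has_finite_dim_def right_base_def)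
    then show False
      using independent_card_le[of B "{z, x, y}"] independent_insert[OF ind z] card by simp
  qed
  then show ?thesis using ind by (auto simp: right_base_def)
qed

locale projective_line = transvection_group s L
  for s :: "'v::ab_group_add \<Rightarrow> 'd::division_ring \<Rightarrow> 'v" and L +
  fixes b0 b1
  assumes b_ne: "b0 \<noteq> b1" and base: "right_base s UNIV {b0, b1}"
begin

lemma b_nz: "b0 \<noteq> 0" "b1 \<noteq> 0" and b1_notin: "b1 \<notin> pt s b0" and b0_notin: "b0 \<notin> pt s b1"
  and pt_b_ne: "pt s b0 \<noteq> pt s b1"
proof -
  have "right_independent s {b0, b1}" using base by (simp add: right_base_def)
  then show *: "b1 \<notin> pt s b0" "b0 \<notin> pt s b1" using b_ne by (auto simp: independent_pair_iff)
  then show "b0 \<noteq> 0" "b1 \<noteq> 0" using subspace_0[OF subspace_pt] by metis+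
  show "pt s b0 \<noteq> pt s b1" using * pt_mem by metis
qed

lemma coordinates: "\<exists>x y. v = s b0 x + s b1 y"
  using base span_pair[of v b0 b1] by (auto simp: right_base_def)

lemma dual_base:
  obtains \<rho>0 \<rho>1 where "right_linear s (*) \<rho>0" "\<rho>0 b0 = 1" "\<rho>0 b1 = 0"
    "right_linear s (*) \<rho>1" "\<rho>1 b0 = 0" "\<rho>1 b1 = 1"
    "\<And>v. v = s b0 (\<rho>0 v) + s b1 (\<rho>1 v)"
proof -
  obtain \<rho>0 where \<rho>0: "right_linear s (*) \<rho>0" "\<And>v. v \<in> pt s b1 \<Longrightarrow> \<rho>0 v = 0" "\<rho>0 b0 = 1"
    using linear_form_exists[OF subspace_pt b0_notin] by blast
  obtain \<rho>1 where \<rho>1: "right_linear s (*) \<rho>1" "\<And>v. v \<in> pt s b0 \<Longrightarrow> \<rho>1 v = 0" "\<rho>1 b1 = 1"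
    using linear_form_exists[OF subspace_pt b1_notin] by blast
  have z: "\<rho>0 b1 = 0" "\<rho>1 b0 = 0" using \<rho>0 \<rho>1 by simp_all
  have "v = s b0 (\<rho>0 v) + s b1 (\<rho>1 v)" for v
  proof -
    obtain x y where v: "v = s b0 x + s b1 y" using coordinates by blast
    show ?thesis
      unfolding v by (simp add: linear_form_simps[OF \<rho>0(1)] linear_form_simps[OF \<rho>1(1)] \<rho>0(3) \<rho>1(3) z)
  qed
  then show thesis using that \<rho>0 \<rho>1 z by blast
qed

abbreviation lp where "lp \<equiv> line_point s b0 b1"

definition vec where "vec z = (case z of None \<Rightarrow> b0 | Some x \<Rightarrow> s b0 x + b1)"

lemma vec_simps [simp]: "vec None = b0" "vec (Some x) = s b0 x + b1"
  by (simp_all add: vec_def)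

lemma lp_vec: "lp z = pt s (vec z)"
  by (cases z) (simp_all add: line_point_def)

lemma vec_nz: "vec z \<noteq> 0"
proof (cases z)
  case (Some x)
  have "s b0 x + b1 \<noteq> 0"
  proof
    assume "s b0 x + b1 = 0"
    then have "b1 = s b0 (- x)" by (simp add: eq_neg_iff_add_eq_0 add.commute)
    then show False using b1_notin by blast
  qed
  then show ?thesis by (simp add: Some)
qed (simp add: b_nz)

lemma bij_lp: "bij_betw lp UNIV (Gr1 s)"
  unfolding bij_betw_def
proof
  show "inj lp"
  proof (rule injI)
    fix z z' assume eq: "lp z = lp z'"
    then have "vec z \<in> pt s (vec z')" using pt_mem by (metis lp_vec)
    then obtain a where a: "vec z = s (vec z') a" by auto
    have ind: "x = x' \<and> y = y'" if "s b0 x + s b1 y = s b0 x' + s b1 y'" for x x' y y'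
      using independent2[OF pt_b_ne b_nz that] .
    have b0_eq: "s b0 1 + s b1 0 = b0" by simp
    show "z = z'"
    proof (cases z; cases z')
      fix x x' assume z: "z = Some x" "z' = Some x'"
      then show ?thesis
        using a ind[of x 1 "x' * a" a] by (simp add: scale_simps)
    next
      fix x' assume z: "z = None" "z' = Some x'"
      then show ?thesis
        using a ind[of 1 0 "x' * a" a] by (auto simp: scale_simps)
    next
      fix x assume z: "z = Some x" "z' = None"
      then show ?thesis
        using a ind[of x 1 a 0] by (auto simp: scale_simps)
    qed simp
  qed
  show "lp ` UNIV = Gr1 s"
  proof
    show "lp ` UNIV \<subseteq> Gr1 s" by (auto simp: lp_vec vec_nz simp del: vec_simps)
    show "Gr1 s \<subseteq> lp ` UNIV"
    proof
      fix p assume "p \<in> Gr1 s"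
      then obtain v where v: "v \<noteq> 0" "p = pt s v" by (rule Gr1E)
      obtain x y where xy: "v = s b0 x + s b1 y" using coordinates by blast
      show "p \<in> lp ` UNIV"
      proof (cases "y = 0")
        case True
        then have "p = lp None" using v xy by (auto simp: lp_vec)
        then show ?thesis by blast
      next
        case False
        then have "v = s (s b0 (x * inverse y) + b1) y" by (simp add: xy scale_simps mult.assoc)
        then have "p = lp (Some (x * inverse y))" using False v by (simp add: lp_vec)
        then show ?thesis by blast
      qed
    qed
  qed
qed

lemma lp_eq_iff: "lp z = lp z' \<longleftrightarrow> z = z'"
  using bij_lp by (auto simp: bij_betw_def inj_eq)

lemma lp_Gr1: "lp z \<in> Gr1 s"
  using bij_lp by (auto simp: bij_betw_def)

lemma Gr1_lpE: "p \<in> Gr1 s \<Longrightarrow> \<exists>z. p = lp z"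
  using bij_lp by (auto simp: bij_betw_def)

definition G where "G = {g. \<exists>f\<in>L. \<forall>z. f ` lp z = lp (g z)}"

lemma G_I:
  assumes "f \<in> L" "\<And>z. f (vec z) \<in> pt s (vec (g z))"
  shows "g \<in> G"
proof -
  have "f ` lp z = lp (g z)" for z
    using pt_eqI[OF _ assms(2), of z] L_eq_0_iff[OF assms(1)]
    by (simp add: lp_vec image_pt[OF assms(1)] vec_nz)
  then show ?thesis using assms(1) by (auto simp: G_def)
qed

lemma G_ex: "f \<in> L \<Longrightarrow> \<exists>g\<in>G. \<forall>z. f ` lp z = lp (g z)"
  unfolding G_def using Gr1_lpE[OF image_Gr1[OF _ lp_Gr1]] by simp metis

lemma scaled_transvection_L:
  assumes "right_linear s (*) \<rho>" "\<rho> u = 0"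
  shows "(\<lambda>v. v + s (s u a) (\<rho> v)) \<in> L"
  by (rule transvection_L) (use assms in \<open>simp_all add: linear_form_simps[OF assms(1)]\<close>)

sublocale projective_line_group G
proof
  obtain \<rho>0 \<rho>1 where \<rho>: "right_linear s (*) \<rho>0" "\<rho>0 b0 = 1" "\<rho>0 b1 = 0"
    "right_linear s (*) \<rho>1" "\<rho>1 b0 = 0" "\<rho>1 b1 = 1"
    using dual_base by blast
  note \<rho>_simps = linear_form_simps[OF \<rho>(1)] linear_form_simps[OF \<rho>(4)] \<rho>(2,3,5,6)
  \<comment> \<open>In coordinates, these are upper and lower unitriangular matrices.\<close>
  let ?t = "\<lambda>a v. v + s (s b0 a) (\<rho>1 v)" and ?l = "\<lambda>v. v + s (s b1 1) (\<rho>0 v)"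
  have t: "?t a \<in> L" for a using \<rho> by (intro scaled_transvection_L)
  have l: "?l \<in> L" using \<rho> by (intro scaled_transvection_L)
  show "g \<circ> h \<in> G" if "g \<in> G" "h \<in> G" for g h
  proof -
    obtain f f' where f: "f \<in> L" "\<And>z. f ` lp z = lp (g z)" "f' \<in> L" "\<And>z. f' ` lp z = lp (h z)"
      using \<open>g \<in> G\<close> \<open>h \<in> G\<close> by (auto simp: G_def)
    have "(f \<circ> f') ` lp z = lp ((g \<circ> h) z)" for z by (simp only: image_comp[symmetric] f comp_apply)
    then show ?thesis unfolding G_def using comp_L[OF f(1,3)] by blast
  qed
  show "shift a \<in> G" for a
  proof (rule G_I[OF t])
    fix z
    show "?t a (vec z) \<in> pt s (vec (shift a z))"
    proof (cases z)
      case (Some x)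
      have "?t a (vec z) = s (vec (shift a z)) 1"
        by (simp add: Some \<rho>_simps scale_simps algebra_simps)
      then show ?thesis by blast
    qed (simp add: \<rho>_simps)
  qed
  show "neg_inverse \<in> G"
  proof (rule G_I)
    \<comment> \<open>The usual factorisation of the matrix with rows \<open>0, -1\<close> and
      \<open>1, 0\<close> into three elementary matrices.\<close>
    let ?f = "?t (- 1) \<circ> (?l \<circ> ?t (- 1))"
    show "?f \<in> L" by (intro comp_L t l)
    have f: "?f (s b0 x + s b1 y) = s b1 x - s b0 y" for x y
      by (simp add: \<rho>_simps scale_simps algebra_simps)
    fix z
    show "?f (vec z) \<in> pt s (vec (neg_inverse z))"
    proof (cases z)
      case None
      then show ?thesis using f[of 1 0] by simp
    next
      case (Some x)
      have fx: "?f (vec z) = s b1 x - b0" using f[of x 1] by (simp add: Some)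
      show ?thesis
      proof (cases "x = 0")
        case True
        then have "?f (vec z) = s (vec (neg_inverse z)) (- 1)" unfolding fx by (simp add: Some)
        then show ?thesis by blast
      next
        case False
        then have "?f (vec z) = s (vec (neg_inverse z)) x"
          unfolding fx by (simp add: Some scale_simps)
        then show ?thesis by blast
      qed
    qed
  qed
  show "\<exists>a b c. a \<noteq> 0 \<and> b \<noteq> 0 \<and> (\<forall>x. g (Some x) = Some (a * x * b + c))"
    if "g \<in> G" "g None = None" for g
  proof -
    obtain f where f: "f \<in> L" "\<And>z. f ` lp z = lp (g z)" using \<open>g \<in> G\<close> by (auto simp: G_def)
    have "f b0 \<in> pt s b0" using f(2)[of None] that(2) by (simp add: lp_vec image_pt[OF f(1)]) (metis pt_mem)
    then obtain a where a: "f b0 = s b0 a" by auto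
    obtain c d where cd: "f b1 = s b0 c + s b1 d" using coordinates by blast
    have "a \<noteq> 0" using a L_eq_0_iff[OF f(1), of b0] b_nz by auto
    have "d \<noteq> 0"
    proof
      assume "d = 0"
      then have "f b1 = f (s b0 (inverse a * c))"
        using \<open>a \<noteq> 0\<close> by (simp add: cd L_simps[OF f(1)] a scale_scale mult.assoc[symmetric])
      then have "b1 = s b0 (inverse a * c)" using bij_L[OF f(1)] by (metis bij_pointE)
      then show False using b1_notin by blast
    qed
    \<comment> \<open>\<open>f\<close> sends \<open>b0 x + b1\<close> to
      \<open>b0 (a x + c) + b1 d\<close>; the last coefficient is normalised by dividing on the
      right.\<close>
    have "g (Some x) = Some (a * x * inverse d + c * inverse d)" for x
    proof -
      have "f (vec (Some x)) = s (vec (Some (a * x * inverse d + c * inverse d))) d"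
        using \<open>d \<noteq> 0\<close> by (simp add: L_simps[OF f(1)] a cd scale_simps mult.assoc add_ac distrib_right)
      then have "lp (g (Some x)) = lp (Some (a * x * inverse d + c * inverse d))"
        unfolding f(2)[symmetric] using \<open>d \<noteq> 0\<close> by (simp add: lp_vec image_pt[OF f(1)] del: vec_simps)
      then show ?thesis by (simp add: lp_eq_iff)
    qed
    then show ?thesis using \<open>a \<noteq> 0\<close> \<open>d \<noteq> 0\<close> by (intro exI[of _ a] exI[of _ "inverse d"] exI[of _ "c * inverse d"]) auto
  qed
qed

end

subsection \<open>Isomorphisms between projective lines\<close>

context permutation_iso
begin

text \<open>Representatives of the images of \<open>b0\<close> and \<open>b1\<close> are rescaled so
  that their sum represents the image of \<open>b0 + b1\<close>; this normalises the coordinate map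
  at 0, 1 and infinity.\<close>

lemma adapted_base:
  assumes "has_finite_dim s2 UNIV 2" "b0 \<noteq> b1" "right_base s1 UNIV {b0, b1}"
  obtains c0 c1 where "c0 \<noteq> c1" "right_base s2 UNIV {c0, c1}" "\<beta> (pt s1 b0) = pt s2 c0"
    "\<beta> (pt s1 b1) = pt s2 c1" "\<beta> (pt s1 (b0 + b1)) = pt s2 (c0 + c1)"
proof -
  interpret P: projective_line s1 L1 b0 b1 by unfold_locales fact+
  have b: "b0 + b1 \<noteq> 0" "pt s1 (b0 + b1) \<noteq> pt s1 b0" "pt s1 (b0 + b1) \<noteq> pt s1 b1"
    using P.vec_nz[of "Some 1"] P.lp_eq_iff[of "Some 1" None] P.lp_eq_iff[of "Some 1" "Some 0"]
    by (simp_all add: P.lp_vec)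
  obtain u v w where uvw: "\<beta> (pt s1 b0) = pt s2 u" "\<beta> (pt s1 b1) = pt s2 v"
    "\<beta> (pt s1 (b0 + b1)) = pt s2 w" "u \<noteq> 0" "v \<noteq> 0" "w \<noteq> 0"
    using \<beta>_Gr1 P.b_nz b(1) by (metis V1.pt_in_Gr1 V2.Gr1E)
  have ne: "pt s2 u \<noteq> pt s2 v" "pt s2 w \<noteq> pt s2 u" "pt s2 w \<noteq> pt s2 v"
    using inj P.b_nz P.pt_b_ne b uvw by (metis V1.pt_in_Gr1)+
  obtain x y where xy: "w = s2 u x + s2 v y"
    using V2.plane_base[OF assms(1) uvw(4,5) ne(1)] V2.span_pair[of w u v] by (auto simp: right_base_def)
  have "x \<noteq> 0"
  proof
    assume "x = 0"
    then have "w \<in> pt s2 v" using xy by auto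
    then show False using ne(3) V2.pt_eqI[OF uvw(6)] by blast
  qed
  have "y \<noteq> 0"
  proof
    assume "y = 0"
    then have "w \<in> pt s2 u" using xy by auto
    then show False using ne(2) V2.pt_eqI[OF uvw(6)] by blast
  qed
  let ?c0 = "s2 u x" and ?c1 = "s2 v y"
  have "right_base s2 UNIV {?c0, ?c1}"
    using uvw ne \<open>x \<noteq> 0\<close> \<open>y \<noteq> 0\<close> by (intro V2.plane_base[OF assms(1)]) simp_all
  moreover have "?c0 \<noteq> ?c1" using ne(1) \<open>x \<noteq> 0\<close> \<open>y \<noteq> 0\<close> by (metis V2.pt_scale)
  ultimately show thesis
    using that[of ?c0 ?c1] uvw xy \<open>x \<noteq> 0\<close> \<open>y \<noteq> 0\<close> by simp
qed

text \<open>\<open>\<theta>\<close> is applied to each homogeneous coordinate. Its multiplicativity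
  makes this semilinear; an anti-isomorphism would put the scalar on the wrong side.\<close>

lemma plane_semilinear:
  assumes "projective_line s1 L1 b0 b1" "projective_line s2 L2 c0 c1"
    and \<theta>: "skew_field_iso \<theta>"
    and \<beta>_lp: "\<And>z. \<beta> (line_point s1 b0 b1 z) = line_point s2 c0 c1 (map_option \<theta> z)"
  shows "\<exists>F. semilinear_iso s1 s2 F \<and> induced_by_semilinear s1 \<beta> F"
proof -
  interpret P1: projective_line s1 L1 b0 b1 by fact
  interpret P2: projective_line s2 L2 c0 c1 by fact
  have \<theta>_simps: "\<theta> (x + y) = \<theta> x + \<theta> y" "\<theta> (x * y) = \<theta> x * \<theta> y" "\<theta> 1 = 1" "bij \<theta>" for x y
    using \<theta> by (auto simp: skew_field_iso_def)
  have \<theta>0: "\<theta> 0 = 0" using \<theta>_simps(1)[of 0 0] by simp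
  have \<theta>_nz: "\<theta> x = 0 \<longleftrightarrow> x = 0" for x using \<theta>_simps(4) \<theta>0 by (metis bij_pointE)
  obtain \<rho>0 \<rho>1 where \<rho>: "right_linear s1 (*) \<rho>0" "\<rho>0 b0 = 1" "\<rho>0 b1 = 0"
    "right_linear s1 (*) \<rho>1" "\<rho>1 b0 = 0" "\<rho>1 b1 = 1"
    and co: "\<And>v. v = s1 b0 (\<rho>0 v) + s1 b1 (\<rho>1 v)"
    using P1.dual_base by blast
  note \<rho>_simps = V1.linear_form_simps[OF \<rho>(1)] V1.linear_form_simps[OF \<rho>(4)] \<rho>(2,3,5,6)
  define F where "F v = s2 c0 (\<theta> (\<rho>0 v)) + s2 c1 (\<theta> (\<rho>1 v))" for v
  have add: "F (v + w) = F v + F w" for v w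
    by (simp add: F_def \<rho>_simps \<theta>_simps V2.scale_simps)
  have scale: "F (s1 v a) = s2 (F v) (\<theta> a)" for v a
    by (simp add: F_def \<rho>_simps \<theta>_simps V2.scale_simps)
  have "bij F"
  proof (rule bijI)
    show "inj_on F UNIV"
    proof (rule injI)
      fix v w assume "F v = F w"
      then have "\<theta> (\<rho>0 v) = \<theta> (\<rho>0 w) \<and> \<theta> (\<rho>1 v) = \<theta> (\<rho>1 w)"
        unfolding F_def by (rule V2.independent2[OF P2.pt_b_ne P2.b_nz])
      then have "\<rho>0 v = \<rho>0 w" "\<rho>1 v = \<rho>1 w" using \<theta>_simps(4) by (metis bij_pointE)+
      then show "v = w" using co[of v] co[of w] by simp
    qed
    show "surj F"
      unfolding surj_def
    proof
      fix u
      obtain x y where u: "u = s2 c0 x + s2 c1 y" using P2.coordinates by blast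
      obtain x' y' where "x = \<theta> x'" "y = \<theta> y'" using \<theta>_simps(4) by (metis bij_pointE)
      then have "u = F (s1 b0 x' + s1 b1 y')" by (simp add: u F_def \<rho>_simps)
      then show "\<exists>v. u = F v" by blast
    qed
  qed
  then have "semilinear_iso s1 s2 F" unfolding semilinear_iso_def using add scale \<theta> by blast
  moreover have "F ` pt s1 v = pt s2 (F v)" for v
  proof
    show "F ` pt s1 v \<subseteq> pt s2 (F v)" by (auto simp: scale)
    show "pt s2 (F v) \<subseteq> F ` pt s1 v"
    proof
      fix u assume "u \<in> pt s2 (F v)"
      then obtain b where "u = s2 (F v) b" by auto
      moreover obtain a where "b = \<theta> a" using \<theta>_simps(4) by (metis bij_pointE)
      ultimately show "u \<in> F ` pt s1 v" by (metis scale image_eqI rangeI)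
    qed
  qed
  then have "F ` P1.lp z = P2.lp (map_option \<theta> z)" for z
    by (cases z) (simp_all add: P1.lp_vec P2.lp_vec F_def \<rho>_simps \<theta>_simps \<theta>0)
  then have "induced_by_semilinear s1 \<beta> F"
    unfolding induced_by_semilinear_def using P1.Gr1_lpE \<beta>_lp by metis
  ultimately show ?thesis by blast
qed

lemma induced_if_planes:
  assumes "has_finite_dim s1 UNIV 2" "has_finite_dim s2 UNIV 2"
  shows "(\<exists>F. semilinear_iso s1 s2 F \<and> induced_by_semilinear s1 \<beta> F) \<or>
    (\<exists>\<theta>. skew_field_anti_iso \<theta> \<and> induced_by_anti_iso s1 s2 \<beta> \<theta>)"
proof -
  obtain B where B: "right_base s1 UNIV B" "card B = 2"
    using assms(1) by (auto simp: has_finite_dim_def)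
  then obtain b0 b1 where b: "b0 \<noteq> b1" "right_base s1 UNIV {b0, b1}"
    by (metis card_2_iff)
  obtain c0 c1 where c: "c0 \<noteq> c1" "right_base s2 UNIV {c0, c1}" "\<beta> (pt s1 b0) = pt s2 c0"
    "\<beta> (pt s1 b1) = pt s2 c1" "\<beta> (pt s1 (b0 + b1)) = pt s2 (c0 + c1)"
    using adapted_base[OF assms(2) b] .
  interpret P1: projective_line s1 L1 b0 b1 by unfold_locales fact+
  interpret P2: projective_line s2 L2 c0 c1 by unfold_locales fact+
  define \<gamma> where "\<gamma> = inv_into UNIV P2.lp \<circ> \<beta> \<circ> P1.lp"
  have "bij_betw (inv_into UNIV P2.lp) (Gr1 s2) UNIV" using P2.bij_lp by (rule bij_betw_inv_into)
  then have bij_\<gamma>: "bij \<gamma>"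
    unfolding \<gamma>_def using bij P1.bij_lp by (intro bij_betw_trans)
  have lp_\<gamma>: "P2.lp (\<gamma> z) = \<beta> (P1.lp z)" for z
    using bij_betw_inv_into_right[OF P2.bij_lp \<beta>_Gr1[OF P1.lp_Gr1]] by (simp add: \<gamma>_def)
  have \<gamma>_eqI: "\<gamma> z = z'" if "\<beta> (P1.lp z) = P2.lp z'" for z z'
    using that by (simp add: lp_\<gamma>[symmetric] P2.lp_eq_iff)
  interpret projective_line_iso P1.G P2.G \<gamma>
  proof
    show "bij \<gamma>" by (rule bij_\<gamma>)
    show "\<gamma> None = None" "\<gamma> (Some 0) = Some 0" "\<gamma> (Some 1) = Some 1"
      by (intro \<gamma>_eqI; simp add: P1.lp_vec P2.lp_vec c)+
    show "\<exists>h\<in>P2.G. \<forall>z. \<gamma> (g z) = h (\<gamma> z)" if "g \<in> P1.G" for g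
    proof -
      obtain f where f: "f \<in> L1" "\<And>z. f ` P1.lp z = P1.lp (g z)" using \<open>g \<in> P1.G\<close> by (auto simp: P1.G_def)
      obtain f' where f': "f' \<in> L2" "\<And>p. p \<in> Gr1 s1 \<Longrightarrow> \<beta> (f ` p) = f' ` \<beta> p" using conj[OF f(1)] by metis
      obtain h where h: "h \<in> P2.G" "\<And>z. f' ` P2.lp z = P2.lp (h z)" using P2.G_ex[OF f'(1)] by blast
      have "\<beta> (P1.lp (g z)) = P2.lp (h (\<gamma> z))" for z
        using f'(2)[OF P1.lp_Gr1, of z] by (simp add: f h(2)[symmetric] lp_\<gamma>)
      then show ?thesis using h(1) \<gamma>_eqI by blast
    qed
    show "\<exists>g\<in>P1.G. \<forall>z. \<gamma> (g z) = h (\<gamma> z)" if "h \<in> P2.G" for h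
    proof -
      obtain f' where f': "f' \<in> L2" "\<And>z. f' ` P2.lp z = P2.lp (h z)" using \<open>h \<in> P2.G\<close> by (auto simp: P2.G_def)
      obtain f where f: "f \<in> L1" "\<And>p. p \<in> Gr1 s1 \<Longrightarrow> \<beta> (f ` p) = f' ` \<beta> p" using conj'[OF f'(1)] by metis
      obtain g where g: "g \<in> P1.G" "\<And>z. f ` P1.lp z = P1.lp (g z)" using P1.G_ex[OF f(1)] by blast
      have "\<beta> (P1.lp (g z)) = P2.lp (h (\<gamma> z))" for z
        using f(2)[OF P1.lp_Gr1, of z] by (simp add: g f'(2)[symmetric] lp_\<gamma>)
      then show ?thesis using g(1) \<gamma>_eqI by blast
    qed
  qed
  have \<beta>_lp: "\<beta> (P1.lp z) = P2.lp (map_option \<theta> z)" for z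
    by (simp only: lp_\<gamma>[symmetric] fun_cong[OF \<beta>_eq, of z, symmetric])
  show ?thesis
  proof (cases "skew_field_iso \<theta>")
    case True
    show ?thesis
      using plane_semilinear[OF P1.projective_line_axioms P2.projective_line_axioms True \<beta>_lp] ..
  next
    case False
    then have "skew_field_anti_iso \<theta>" using \<theta>_iso_or_anti_iso by blast
    moreover have "induced_by_anti_iso s1 s2 \<beta> \<theta>"
      unfolding induced_by_anti_iso_def using b c(1,2) \<beta>_lp by blast
    ultimately show ?thesis by blast
  qed
qed

text \<open>
  On a projective line, the commutator of a translation with an element of the stabilizer of its centre
  is a translation, thus without further fixed points if nontrivial; in dimension at least 3 the
  commutator of a transvection with any map fixing its centre is a transvection.
\<close>

lemma no_iso_line_to_higher_dim:
  assumes base: "b0 \<noteq> b1" "right_base s1 UNIV {b0, b1}"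
    and np2: "\<And>x y. right_span s2 {x, y} \<noteq> UNIV"
  shows False
proof -
  interpret P: projective_line s1 L1 b0 b1 by unfold_locales fact+
  define \<gamma> where "\<gamma> z = \<beta> (P.lp z)" for z
  have \<gamma>_Gr1: "\<gamma> z \<in> Gr1 s2" for z by (simp add: \<gamma>_def \<beta>_Gr1 P.lp_Gr1)
  have \<gamma>_inj: "\<gamma> z = \<gamma> z' \<longleftrightarrow> z = z'" for z z' by (simp add: \<gamma>_def inj P.lp_Gr1 P.lp_eq_iff)
  have \<gamma>_surj: "\<exists>z. p = \<gamma> z" if "p \<in> Gr1 s2" for p
    using \<beta>_surj[OF that] P.Gr1_lpE by (metis \<gamma>_def)
  obtain r where r: "r \<in> Gr1 s2" "\<not> r \<subseteq> right_span s2 (\<gamma> None \<union> \<gamma> (Some 0))"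
    using V2.noncollinear_exists[OF np2 \<gamma>_Gr1 \<gamma>_Gr1] by blast
  then have "r \<noteq> \<gamma> None" using V2.span_superset[of "\<gamma> None \<union> \<gamma> (Some 0)"] by auto
  then obtain a where a: "r = \<gamma> (Some a)" using \<gamma>_surj[OF r(1)] by (metis option.exhaust)
  obtain u y z where uyz: "\<gamma> None = pt s2 u" "\<gamma> (Some 0) = pt s2 y" "r = pt s2 z"
    "u \<noteq> 0" "y \<noteq> 0" "z \<noteq> 0"
    using \<gamma>_Gr1 r(1) by (metis V2.Gr1E)
  have "pt s2 u \<noteq> pt s2 y" using \<gamma>_inj[of None "Some 0"] uyz by simp
  then have y_notin: "y \<notin> pt s2 u" using V2.pt_eqI[OF uyz(5)] by metis
  have z_notin: "z \<notin> right_span s2 {u, y}"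
    using r(2) by (simp add: uyz V2.span_Un_pt V2.pt_subset_iff[OF V2.subspace_span])
  obtain \<rho> where \<rho>: "right_linear s2 (*) \<rho>" "\<And>v. v \<in> right_span s2 {u, y} \<Longrightarrow> \<rho> v = 0" "\<rho> z = 1"
    using V2.linear_form_exists[OF V2.subspace_span z_notin] by blast
  have \<rho>0: "\<rho> u = 0" "\<rho> y = 0" by (auto intro!: \<rho>(2) V2.span_base)
  note \<rho>_simps = V2.linear_form_simps[OF \<rho>(1)] \<rho>0 \<rho>(3)
  \<comment> \<open>A transvection with centre \<open>\<gamma> None\<close> that fixes
    \<open>\<gamma> (Some 0)\<close> and moves \<open>r\<close>; on the line it becomes a map
    \<open>b * x * c\<close> with \<open>b * a * c \<noteq> a\<close>.\<close>
  let ?\<sigma> = "\<lambda>v. v + s2 u (\<rho> v)"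
  have \<sigma>: "?\<sigma> \<in> L2" using \<rho>(1) \<rho>0 by (intro V2.transvection_L)
  obtain f where f: "f \<in> L1" "\<And>p. p \<in> Gr1 s1 \<Longrightarrow> \<beta> (f ` p) = ?\<sigma> ` \<beta> p" using conj'[OF \<sigma>] by metis
  obtain g where g: "g \<in> P.G" "\<And>z. f ` P.lp z = P.lp (g z)" using P.G_ex[OF f(1)] by blast
  have \<gamma>g: "\<gamma> (g t) = ?\<sigma> ` \<gamma> t" for t
    using f(2)[OF P.lp_Gr1, of t] by (simp add: g(2) \<gamma>_def)
  obtain k where k: "k \<in> L1" "\<And>z. k ` P.lp z = P.lp (shift a z)" using P.shift_G[of a] by (auto simp: P.G_def)
  obtain h where h: "h \<in> L2" "\<And>p. p \<in> Gr1 s1 \<Longrightarrow> \<beta> (k ` p) = h ` \<beta> p" using conj[OF k(1)] by metis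
  have \<gamma>h: "\<gamma> (shift a t) = h ` \<gamma> t" for t
    using h(2)[OF P.lp_Gr1, of t] by (simp add: k(2) \<gamma>_def)
  have "\<gamma> (g None) = \<gamma> None" "\<gamma> (g (Some 0)) = \<gamma> (Some 0)"
    unfolding \<gamma>g by (simp_all add: uyz V2.image_pt[OF \<sigma>] \<rho>_simps)
  then have g_fix: "g None = None" "g (Some 0) = Some 0" by (simp_all add: \<gamma>_inj)
  then obtain b c where g_Some: "\<And>x. g (Some x) = Some (b * x * c)"
    using P.affine_G[OF g(1)] by fastforce
  have "z + u \<notin> pt s2 z"
  proof
    assume "z + u \<in> pt s2 z"
    then have "u \<in> pt s2 z" using V2.subspace_diff[OF V2.subspace_pt, of "z + u" z z] by simp
    then have "pt s2 u = pt s2 z" using V2.pt_eqI[OF uyz(4)] by blast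
    then have "z \<in> pt s2 u" by simp
    then show False using z_notin V2.subspace_scale[OF V2.subspace_span V2.span_base, of u] by auto
  qed
  then have "\<gamma> (g (Some a)) \<noteq> \<gamma> (Some a)"
    unfolding \<gamma>g a[symmetric] uyz(3) V2.image_pt[OF \<sigma>] by (simp add: \<rho>_simps) (metis V2.pt_mem)
  then have ne: "b * a * c \<noteq> a" by (simp add: g_Some \<gamma>_inj)
  \<comment> \<open>The two orders of composition differ at every finite \<open>x\<close>, because
    \<open>b * (x + a) * c\<close> and \<open>b * x * c + a\<close> differ by the constant
    \<open>b * a * c - a\<close>.\<close>
  have moved: "?\<sigma> ` h ` p \<noteq> h ` ?\<sigma> ` p" if p: "p \<in> Gr1 s2" "p \<noteq> pt s2 u" for p
  proof -
    obtain t where t: "p = \<gamma> t" using \<gamma>_surj[OF p(1)] by blast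
    then obtain x where x: "t = Some x" using p(2) uyz(1) by (cases t) auto
    have "g (shift a t) \<noteq> shift a (g t)" using ne by (simp add: x g_Some algebra_simps)
    then have "\<gamma> (g (shift a t)) \<noteq> \<gamma> (shift a (g t))" by (simp only: \<gamma>_inj not_False_eq_True)
    then show ?thesis by (simp only: \<gamma>g \<gamma>h t not_False_eq_True)
  qed
  have "pt s2 (h u) = pt s2 u" using \<gamma>h[of None] by (simp add: uyz V2.image_pt[OF h(1)])
  then obtain c' where c': "h u = s2 u c'" using V2.pt_mem[of "h u"] by auto
  \<comment> \<open>\<open>?\<sigma> (h v)\<close> and \<open>h (?\<sigma> v)\<close> differ by
    \<open>u\<close> times \<open>\<mu> v\<close>.\<close>
  define \<mu> where "\<mu> v = \<rho> (h v) - c' * \<rho> v" for v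
  note h_simps = V2.L_simps[OF h(1)]
  have \<mu>_simps: "\<mu> (v - w) = \<mu> v - \<mu> w" "\<mu> (s2 v x) = \<mu> v * x" for v w x
    by (simp_all add: \<mu>_def \<rho>_simps h_simps algebra_simps)
  have \<mu>_nz: "\<mu> v \<noteq> 0" if "v \<notin> pt s2 u" for v
  proof
    assume "\<mu> v = 0"
    then have "?\<sigma> (h v) = h (?\<sigma> v)" by (simp add: \<mu>_def h_simps c' V2.scale_scale)
    moreover have "v \<noteq> 0" using that V2.subspace_0[OF V2.subspace_pt] by metis
    moreover have "pt s2 v \<noteq> pt s2 u" using that V2.pt_mem by metis
    ultimately show False
      using moved[of "pt s2 v"] by (simp only: V2.image_pt[OF \<sigma>] V2.image_pt[OF h(1)] V2.pt_in_Gr1) simp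
  qed
  \<comment> \<open>The linear form \<open>\<mu>\<close> has a nonzero zero in every plane, in
    particular in the span of \<open>y\<close> and \<open>z\<close>, which meets \<open>uD\<close>
    trivially.\<close>
  let ?v = "z - s2 y (inverse (\<mu> y) * \<mu> z)"
  have "\<mu> ?v = 0" using \<mu>_nz[OF y_notin] by (simp add: \<mu>_simps mult.assoc[symmetric])
  moreover have "?v \<notin> pt s2 u"
  proof
    assume "?v \<in> pt s2 u"
    then obtain x where "?v = s2 u x" by auto
    then have "z = s2 u x + s2 y (inverse (\<mu> y) * \<mu> z)" by (simp add: algebra_simps)
    then show False using z_notin V2.span_pair by blast
  qed
  ultimately show False using \<mu>_nz by blast
qed

end

section \<open>The groups \<open>H\<^sub>i\<close>\<close>

lemma carrier_GL: "carrier (GL s) = {g. bij g \<and> right_linear s s g}"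
  by (simp add: GL_def)

text \<open>The full preimage of \<open>H\<close> in \<open>GL\<close>; a choice of one
  representative per permutation need not be closed under composition.\<close>

definition inducing_maps ::
  "('v::ab_group_add \<Rightarrow> 'd::division_ring \<Rightarrow> 'v) \<Rightarrow> ('v set \<Rightarrow> 'v set) set \<Rightarrow> ('v \<Rightarrow> 'v) set"
  where "inducing_maps s H = {g. bij g \<and> right_linear s s g \<and> perm_Gr1 s g \<in> H}"

context right_vector_space
begin

lemma transvection_bij_linear:
  assumes "right_linear s (*) \<rho>" "\<rho> u = 0"
  shows "bij (\<lambda>v. v + s u (\<rho> v))" "right_linear s s (\<lambda>v. v + s u (\<rho> v))"
proof -
  note \<rho>_simps = linear_form_simps[OF assms(1)] assms(2)
  show "bij (\<lambda>v. v + s u (\<rho> v))"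
    by (rule o_bij[of "\<lambda>v. v - s u (\<rho> v)"]) (auto simp: \<rho>_simps)
  show "right_linear s s (\<lambda>v. v + s u (\<rho> v))"
    by (simp add: right_linear_def \<rho>_simps scale_simps)
qed

lemma linear_inverse:
  assumes "bij g" "right_linear s s g"
  shows "right_linear s s (inv_into UNIV g)"
proof -
  let ?i = "inv_into UNIV g"
  have i: "?i (g v) = v" "g (?i v) = v" for v
    using assms(1) by (simp_all add: bij_is_inj bij_is_surj surj_f_inv_f)
  have g: "g (v + w) = g v + g w" "g (s v a) = s (g v) a" for v w a
    using assms(2) by (auto simp: right_linear_def)
  have "?i (v + w) = ?i v + ?i w" for v w
    using i(1)[of "?i v + ?i w"] by (simp add: g i(2))
  moreover have "?i (s v a) = s (?i v) a" for v a
    using i(1)[of "s (?i v) a"] by (simp add: g i(2))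
  ultimately show ?thesis by (simp add: right_linear_def)
qed

lemma transvection_group_inducing_maps:
  assumes H: "subgroup H (BijGroup (Gr1 s))" and PEL: "PEL s \<subseteq> H"
  shows "transvection_group s (inducing_maps s H)"
proof
  let ?B = "BijGroup (Gr1 s)"
  have sub: "H \<subseteq> Bij (Gr1 s)" using subgroup.subset[OF H] by (simp add: BijGroup_def)
  have mult: "h \<otimes>\<^bsub>?B\<^esub> k = compose (Gr1 s) h k" if "h \<in> H" "k \<in> H" for h k
    using that sub by (auto simp: BijGroup_def)
  show "g \<circ> h \<in> inducing_maps s H" if g: "g \<in> inducing_maps s H" and h: "h \<in> inducing_maps s H" for g h
  proof -
    have "perm_Gr1 s g \<otimes>\<^bsub>?B\<^esub> perm_Gr1 s h \<in> H"
      using g h by (intro subgroup.m_closed[OF H]) (auto simp: inducing_maps_def)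
    moreover have "perm_Gr1 s g \<otimes>\<^bsub>?B\<^esub> perm_Gr1 s h = compose (Gr1 s) (perm_Gr1 s g) (perm_Gr1 s h)"
      using g h by (intro mult) (auto simp: inducing_maps_def)
    also have "\<dots> = perm_Gr1 s (g \<circ> h)"
      using h by (auto simp: compose_def perm_Gr1_def inducing_maps_def linear_image_Gr1 image_image
          intro!: restrict_ext)
    ultimately show ?thesis
      using g h by (auto simp: inducing_maps_def bij_comp right_linear_def)
  qed
  show "inv_into UNIV g \<in> inducing_maps s H" if g: "g \<in> inducing_maps s H" for g
  proof -
    let ?i = "inv_into UNIV g"
    have bl: "bij g" "right_linear s s g" "perm_Gr1 s g \<in> H" using g by (auto simp: inducing_maps_def)
    define k where "k = inv\<^bsub>?B\<^esub> perm_Gr1 s g"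
    have k: "k \<in> H" unfolding k_def using bl(3) by (rule subgroup.m_inv_closed[OF H])
    have "perm_Gr1 s g \<otimes>\<^bsub>?B\<^esub> k = \<one>\<^bsub>?B\<^esub>"
      unfolding k_def using bl(3) subgroup.subset[OF H]
      by (intro group.r_inv group_BijGroup) blast
    then have eq: "compose (Gr1 s) (perm_Gr1 s g) k = (\<lambda>x\<in>Gr1 s. x)"
      using mult[OF bl(3) k] by (simp add: BijGroup_def)
    have k_Bij: "k \<in> Bij (Gr1 s)" using k sub by blast
    \<comment> \<open>The abstract group inverse \<open>k\<close> is identified pointwise with the
      action of the inverse map.\<close>
    have kp: "k p = ?i ` p" if p: "p \<in> Gr1 s" for p
    proof -
      have "k p \<in> Gr1 s" using k_Bij p by (auto simp: Bij_def bij_betw_def)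
      then have "g ` k p = p"
        using fun_cong[OF eq, of p] p by (simp add: compose_def perm_Gr1_def)
      then have "?i ` p = ?i ` g ` k p" by simp
      also have "\<dots> = k p" using bl(1) by (simp add: image_comp bij_is_inj)
      finally show ?thesis by simp
    qed
    have "perm_Gr1 s ?i = k"
      using k_Bij kp by (intro extensionalityI[of _ "Gr1 s"]) (auto simp: perm_Gr1_def Bij_def)
    then show ?thesis
      using k bl linear_inverse bij_imp_bij_inv by (auto simp: inducing_maps_def)
  qed
  show "(\<lambda>v. v + s u (\<rho> v)) \<in> inducing_maps s H" if \<rho>: "right_linear s (*) \<rho>" "\<rho> u = 0" for \<rho> u
  proof -
    have "(\<lambda>v. v + s u (\<rho> v)) \<in> EL s"
      unfolding EL_def using \<rho> by (intro generate.incl) (auto simp: transvections_def)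
    then have "perm_Gr1 s (\<lambda>v. v + s u (\<rho> v)) \<in> H" using PEL by (auto simp: PEL_def)
    then show ?thesis using transvection_bij_linear[OF \<rho>] by (simp add: inducing_maps_def)
  qed
qed (auto simp: inducing_maps_def)

lemma PGL_inducing_map:
  assumes "H \<subseteq> PGL s" "h \<in> H"
  obtains g where "g \<in> inducing_maps s H" "h = perm_Gr1 s g"
  using assms by (auto simp: PGL_def inducing_maps_def carrier_GL)

lemma not_plane_if_dim_ge_3:
  assumes "has_finite_dim s UNIV n" "n \<ge> 3"
  shows "right_span s {x, y} \<noteq> UNIV"
proof
  assume "right_span s {x, y} = UNIV"
  then have "n \<le> card {x, y}" using finite_dim_le[OF assms(1)] by simp
  also have "\<dots> \<le> 2" by (simp add: card_insert_if)
  finally show False using assms(2) by simp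
qed

end

lemma permutation_iso_inducing_maps:
  assumes "right_vector_space s1" and "right_vector_space s2"
    and H1: "subgroup H1 (BijGroup (Gr1 s1))" "PEL s1 \<subseteq> H1" "H1 \<subseteq> PGL s1"
    and H2: "subgroup H2 (BijGroup (Gr1 s2))" "PEL s2 \<subseteq> H2" "H2 \<subseteq> PGL s2"
    and iso: "perm_group_iso H1 (Gr1 s1) H2 (Gr1 s2) \<phi> \<beta>"
  shows "permutation_iso s1 (inducing_maps s1 H1) s2 (inducing_maps s2 H2) \<beta>"
proof -
  interpret V1: right_vector_space s1 by fact
  interpret V2: right_vector_space s2 by fact
  interpret V1: transvection_group s1 "inducing_maps s1 H1"
    using H1(1,2) by (rule V1.transvection_group_inducing_maps)
  interpret V2: transvection_group s2 "inducing_maps s2 H2"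
    using H2(1,2) by (rule V2.transvection_group_inducing_maps)
  have \<phi>: "bij_betw \<phi> H1 H2" and \<beta>: "bij_betw \<beta> (Gr1 s1) (Gr1 s2)"
    and eqv: "\<And>h p. h \<in> H1 \<Longrightarrow> p \<in> Gr1 s1 \<Longrightarrow> \<beta> (h p) = \<phi> h (\<beta> p)"
    using iso by (auto simp: perm_group_iso_def iso_def)
  have \<beta>_Gr1: "\<beta> p \<in> Gr1 s2" if "p \<in> Gr1 s1" for p using \<beta> that by (auto simp: bij_betw_def)
  have conj: "\<beta> (g ` p) = h ` \<beta> p"
    if "perm_Gr1 s1 g \<in> H1" "\<phi> (perm_Gr1 s1 g) = perm_Gr1 s2 h" "p \<in> Gr1 s1" for g h p
    using eqv[OF that(1,3)] that(3) \<beta>_Gr1[OF that(3)] unfolding that(2) by (simp add: perm_Gr1_def)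
  show ?thesis
  proof
    show "bij_betw \<beta> (Gr1 s1) (Gr1 s2)" by (rule \<beta>)
    show "\<exists>h\<in>inducing_maps s2 H2. \<forall>p\<in>Gr1 s1. \<beta> (g ` p) = h ` \<beta> p"
      if "g \<in> inducing_maps s1 H1" for g
    proof -
      have g: "perm_Gr1 s1 g \<in> H1" using that by (simp add: inducing_maps_def)
      then have "\<phi> (perm_Gr1 s1 g) \<in> H2" using \<phi> by (auto simp: bij_betw_def)
      then obtain h where "h \<in> inducing_maps s2 H2" "\<phi> (perm_Gr1 s1 g) = perm_Gr1 s2 h"
        by (rule V2.PGL_inducing_map[OF H2(3)])
      then show ?thesis using conj[OF g] by blast
    qed
    show "\<exists>g\<in>inducing_maps s1 H1. \<forall>p\<in>Gr1 s1. \<beta> (g ` p) = h ` \<beta> p"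
      if "h \<in> inducing_maps s2 H2" for h
    proof -
      have "perm_Gr1 s2 h \<in> \<phi> ` H1" using that \<phi> by (simp add: inducing_maps_def bij_betw_def)
      then obtain k where k: "k \<in> H1" "\<phi> k = perm_Gr1 s2 h" by auto
      obtain g where g: "g \<in> inducing_maps s1 H1" "k = perm_Gr1 s1 g"
        using k(1) by (rule V1.PGL_inducing_map[OF H1(3)])
      then show ?thesis using conj[of g h] k by blast
    qed
  qed
qed

theorem mainTheorem3:
  fixes s1 :: "'v1::ab_group_add \<Rightarrow> 'd1::division_ring \<Rightarrow> 'v1"
    and s2 :: "'v2::ab_group_add \<Rightarrow> 'd2::division_ring \<Rightarrow> 'v2"
    and n1 n2 :: nat
    and H1 :: "('v1 set \<Rightarrow> 'v1 set) set" and H2 :: "('v2 set \<Rightarrow> 'v2 set) set"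
    and \<phi> :: "('v1 set \<Rightarrow> 'v1 set) \<Rightarrow> ('v2 set \<Rightarrow> 'v2 set)"
    and \<beta> :: "'v1 set \<Rightarrow> 'v2 set"
  assumes "right_vector_space s1" and "right_vector_space s2"
    and "has_finite_dim s1 UNIV n1" and "has_finite_dim s2 UNIV n2"
    and "n1 \<ge> 2" and "n2 \<ge> 2"
    and "subgroup H1 (BijGroup (Gr1 s1))" and "PEL s1 \<subseteq> H1" and "H1 \<subseteq> PGL s1"
    and "subgroup H2 (BijGroup (Gr1 s2))" and "PEL s2 \<subseteq> H2" and "H2 \<subseteq> PGL s2"
    and "perm_group_iso H1 (Gr1 s1) H2 (Gr1 s2) \<phi> \<beta>"
  shows "n1 = n2 \<and>
    (n1 \<ge> 3 \<longrightarrow> (\<exists>F. semilinear_iso s1 s2 F \<and> induced_by_semilinear s1 \<beta> F)) \<and>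
    (n1 = 2 \<longrightarrow>
      (\<exists>F. semilinear_iso s1 s2 F \<and> induced_by_semilinear s1 \<beta> F) \<or>
      (\<exists>\<theta>. skew_field_anti_iso \<theta> \<and> induced_by_anti_iso s1 s2 \<beta> \<theta>))"
proof -
  interpret permutation_iso s1 "inducing_maps s1 H1" s2 "inducing_maps s2 H2" \<beta>
    by (rule permutation_iso_inducing_maps) fact+
  interpret inverse: permutation_iso s2 "inducing_maps s2 H2" s1 "inducing_maps s1 H1"
      "inv_into (Gr1 s1) \<beta>"
    by (rule permutation_iso_sym)
  have base: "\<exists>b0 b1. b0 \<noteq> b1 \<and> right_base t UNIV {b0, b1}" if "has_finite_dim t UNIV 2"
    for t :: "'v::ab_group_add \<Rightarrow> 'd::division_ring \<Rightarrow> 'v"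
    using that unfolding has_finite_dim_def by (metis card_2_iff)
  consider "n1 = 2" "n2 = 2" | "n1 = 2" "n2 \<ge> 3" | "n1 \<ge> 3" "n2 = 2" | "n1 \<ge> 3" "n2 \<ge> 3"
    using assms(5,6) by linarith
  then show ?thesis
  proof cases
    case 1
    then show ?thesis using induced_if_planes assms(3,4) by simp
  next
    case 2
    then show ?thesis
      using no_iso_line_to_higher_dim base assms(3) V2.not_plane_if_dim_ge_3[OF assms(4)] by metis
  next
    case 3
    then show ?thesis
      using inverse.no_iso_line_to_higher_dim base assms(4) V1.not_plane_if_dim_ge_3[OF assms(3)] by metis
  next
    case 4
    note not_planes = V1.not_plane_if_dim_ge_3[OF assms(3) 4(1)]
      V2.not_plane_if_dim_ge_3[OF assms(4) 4(2)]
    obtain F where F: "semilinear_iso s1 s2 F" "induced_by_semilinear s1 \<beta> F"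
      using semilinear_if_not_planes[OF not_planes] by blast
    \<comment> \<open>The inverse of \<open>\<beta>\<close> supplies the reverse inequality of
      dimensions.\<close>
    obtain F' where "semilinear_iso s2 s1 F'"
      using inverse.semilinear_if_not_planes[OF not_planes(2,1)] by blast
    then have "n1 = n2"
      using F(1) semilinear_iso_dim assms(1-4) by (metis antisym)
    then show ?thesis using F 4 by auto
  qed
qed

end
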